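(* Fix any integer $d\geq 3$, any prime power $q$, and a set $S\subseteq [d-1]$ with $|S|\geq 2$. Let $s$ be any face of the projected flags complex $\mathcal{B}^{d,S}_q$ of co-dimension at least $2$ (i.e. $|S|-|s|\geq 2$). Then the second largest eigenvalue of the normalized adjacency operator of the underlying graph of the link of $s$ in $\mathcal{B}^{d,S}_q$ is at most $\frac{2}{(|S|-|s|-1)(\sqrt{q}-1)}$. In particular, $\mathcal{B}^{d,S}_q$ is a $\frac{2}{\sqrt{q}-1}$-(one-sided) local spectral expander. Moreover, $\mathcal{B}^{d,S}_q$ is a $\frac{1}{\sqrt{q}}$-product.
   Context: For a prime power $q$, integer $d$, and $S=\{s_1<\dots<s_k\}\subseteq[d-1]$, the projected flags complex $\mathcal{B}^{d,S}_q$ is the $k$-partite simplicial complex whose vertices are the subspaces $W\subseteq\mathbb{F}_q^d$ with $\dim W\in S$ (the color of a vertex is its dimension), and whose top faces are the chains $W_1\subset W_2\subset\cdots\subset W_k$ with $\dim W_i=s_i$; faces are all subsets of top faces. The complex is weighted by the uniform distribution on top faces; the distribution on $i$-faces is obtained by sampling a top face and a uniformly random subset of size $i+1$. The link of a face $s$ is $X_s=\{t\setminus s: t\in X, t\supseteq s\}$ with the induced (conditional) distribution; its underlying graph has vertices $X_s(0)$, edges $X_s(1)$, edge weights from this distribution, and normalized adjacency operator $\mathsf{A}f(v)=\frac{1}{2\pi_0(v)}\sum_{u\sim v}\pi_1(uv)f(u)$, where $\pi_0$ is the induced vertex distribution. A $D$-dimensional complex $X$ is a $\lambda$-(one-sided)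 local spectral expander if for every face $s$ of dimension at most $D-2$ (including the empty face) the second largest eigenvalue of the underlying graph of $X_s$ is at most $\lambda$. A partite complex $X$ is a $\lambda$-product if for every face $\tau$ of co-dimension at least $2$ and every two colors $i\neq j$ not in the colors of $\tau$, the bipartite graph induced on vertices of colors $i,j$ in $X_\tau$ has second largest eigenvalue at most $\lambda$. *)

theory Defs
  imports "HOL-Library.Function_Algebras" "Jordan_Normal_Form.Char_Poly"
begin

text \<open>Vectors of F^d are functions 'n => 'a with d = CARD('n) and 'a a finite field
  (so q = CARD('a) ranges over all prime powers).  Scalar multiplication:\<close>

definition vscale :: "'a::field \<Rightarrow> ('n \<Rightarrow> 'a) \<Rightarrow> ('n \<Rightarrow> 'a)" where
  "vscale c v = (\<lambda>i. c * v i)"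

definition is_subspace :: "('n \<Rightarrow> 'a::field) set \<Rightarrow> bool" where
  "is_subspace W = module.subspace vscale W"

definition sdim :: "('n \<Rightarrow> 'a::field) set \<Rightarrow> nat" where
  "sdim W = vector_space.dim vscale W"

definition pf_vertices :: "nat set \<Rightarrow> ('n \<Rightarrow> 'a::{field,finite}) set set" where
  "pf_vertices S = {W. is_subspace W \<and> sdim W \<in> S}"

definition pf_top :: "nat set \<Rightarrow> ('n \<Rightarrow> 'a::{field,finite}) set set set" where
  "pf_top S = {F. F \<subseteq> pf_vertices S \<and> bij_betw sdim F S
                 \<and> (\<forall>U\<in>F. \<forall>W\<in>F. U \<subseteq> W \<or> W \<subseteq> U)}"

definition faces_of :: "'v set set \<Rightarrow> 'v set set" where
  "faces_of Top = {s. \<exists>T\<in>Top. s \<subseteq> T}"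

text \<open>A pure complex is given by its (finite) set of top faces Top, weighted by the
  uniform distribution on Top.  The link of a face s carries the conditional distribution:
  its top faces T - s for T \<in> Top with s \<subseteq> T, uniformly.\<close>

definition link_tops :: "'v set set \<Rightarrow> 'v set \<Rightarrow> 'v set set" where
  "link_tops Top s = {T \<in> Top. s \<subseteq> T}"

definition link_vertices :: "'v set set \<Rightarrow> 'v set \<Rightarrow> 'v set" where
  "link_vertices Top s = (\<Union>T\<in>link_tops Top s. T - s)"

text \<open>Vertex distribution pi_0 of the link: sample a top face of the link uniformly,
  then a uniformly random vertex of it.\<close>
definition link_pi0 :: "'v set set \<Rightarrow> 'v set \<Rightarrow> 'v \<Rightarrow> real" where
  "link_pi0 Top s v = (\<Sum>T\<in>{T\<in>link_tops Top s. v \<in> T - s}. 1 / real (card (T - s)))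
                       / real (card (link_tops Top s))"

text \<open>Edge distribution pi_1 of the link: sample a top face of the link uniformly,
  then a uniformly random 2-subset of it.\<close>
definition link_pi1 :: "'v set set \<Rightarrow> 'v set \<Rightarrow> 'v \<Rightarrow> 'v \<Rightarrow> real" where
  "link_pi1 Top s u v = (\<Sum>T\<in>{T\<in>link_tops Top s. {u, v} \<subseteq> T - s}. 1 / real (card (T - s) choose 2))
                       / real (card (link_tops Top s))"

definition link_edge :: "'v set set \<Rightarrow> 'v set \<Rightarrow> 'v \<Rightarrow> 'v \<Rightarrow> bool" where
  "link_edge Top s u v \<longleftrightarrow> u \<noteq> v \<and> (\<exists>T\<in>link_tops Top s. {u, v} \<subseteq> T - s)"

text \<open>Normalized adjacency operator A f(v) = 1/(2 pi_0(v)) * sum_{u ~ v} pi_1(uv) f(u),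
  given as its matrix entry (v,u).\<close>
definition link_adj :: "'v set set \<Rightarrow> 'v set \<Rightarrow> 'v \<Rightarrow> 'v \<Rightarrow> real" where
  "link_adj Top s v u = (if link_edge Top s u v
                          then link_pi1 Top s u v / (2 * link_pi0 Top s v) else 0)"

text \<open>For an operator on real functions on a finite set V, given by its kernel M
  (A f(v) = sum_u M v u f(u)), we form the matrix w.r.t. some enumeration of V (the
  spectrum does not depend on the enumeration); its eigenvalues, with (algebraic)
  multiplicity, are the roots of the characteristic polynomial.\<close>

definition enum_of :: "'v set \<Rightarrow> 'v list" where
  "enum_of V = (SOME xs. distinct xs \<and> set xs = V)"

definition op_matrix :: "'v set \<Rightarrow> ('v \<Rightarrow> 'v \<Rightarrow> real) \<Rightarrow> real mat" where
  "op_matrix V M = (let xs = enum_of V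
                    in mat (length xs) (length xs) (\<lambda>(i, j). M (xs ! i) (xs ! j)))"

definition eigenvalues_desc :: "'v set \<Rightarrow> ('v \<Rightarrow> 'v \<Rightarrow> real) \<Rightarrow> real list" where
  "eigenvalues_desc V M = rev (sorted_list_of_multiset (proots (char_poly (op_matrix V M))))"

definition second_eig :: "'v set \<Rightarrow> ('v \<Rightarrow> 'v \<Rightarrow> real) \<Rightarrow> real" where
  "second_eig V M = eigenvalues_desc V M ! 1"

definition link_lambda2 :: "'v set set \<Rightarrow> 'v set \<Rightarrow> real" where
  "link_lambda2 Top s = second_eig (link_vertices Top s) (link_adj Top s)"

text \<open>Top :: set of top faces of a pure complex of dimension D = k-1 (k = size of top faces).
  lambda-one-sided local spectral expander: every face s of dimension at most D-2,
  i.e. with |s| <= k-2 (including the empty face), has lambda_2(X_s) <= lambda.\<close>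
definition local_spectral_expander :: "nat \<Rightarrow> 'v set set \<Rightarrow> real \<Rightarrow> bool" where
  "local_spectral_expander k Top lam \<longleftrightarrow>
     (\<forall>s\<in>faces_of Top. card s + 2 \<le> k \<longrightarrow> link_lambda2 Top s \<le> lam)"

definition bip_vertices :: "'v set set \<Rightarrow> ('v \<Rightarrow> nat) \<Rightarrow> 'v set \<Rightarrow> nat \<Rightarrow> nat \<Rightarrow> 'v set" where
  "bip_vertices Top colour t i j = {v \<in> link_vertices Top t. colour v = i \<or> colour v = j}"

definition bip_weight :: "'v set set \<Rightarrow> ('v \<Rightarrow> nat) \<Rightarrow> 'v set \<Rightarrow> nat \<Rightarrow> nat \<Rightarrow> 'v \<Rightarrow> 'v \<Rightarrow> real" where
  "bip_weight Top colour t i j u v =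
     (if link_edge Top t u v \<and> ((colour u = i \<and> colour v = j) \<or> (colour u = j \<and> colour v = i))
      then link_pi1 Top t u v else 0)"

definition bip_adj :: "'v set set \<Rightarrow> ('v \<Rightarrow> nat) \<Rightarrow> 'v set \<Rightarrow> nat \<Rightarrow> nat \<Rightarrow> 'v \<Rightarrow> 'v \<Rightarrow> real" where
  "bip_adj Top colour t i j v u =
     bip_weight Top colour t i j u v
       / (\<Sum>w\<in>bip_vertices Top colour t i j. bip_weight Top colour t i j w v)"

definition is_product :: "nat set \<Rightarrow> ('v \<Rightarrow> nat) \<Rightarrow> 'v set set \<Rightarrow> real \<Rightarrow> bool" where
  "is_product C colour Top lam \<longleftrightarrow>
     (\<forall>t\<in>faces_of Top. card t + 2 \<le> card C \<longrightarrow>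
        (\<forall>i\<in>C - colour ` t. \<forall>j\<in>C - colour ` t. i \<noteq> j \<longrightarrow>
           second_eig (bip_vertices Top colour t i j) (bip_adj Top colour t i j) \<le> lam))"

end

theory Submission
  imports Defs "Jordan_Normal_Form.Schur_Decomposition" "HOL-Analysis.Convex" "HOL-Library.Cardinality"
begin

text \<open>The number of top faces over a chain depends only on the dimensions occurring in it, so
  between two colours \<open>i < j\<close> the link of \<open>s\<close> carries the uniform distribution on incident pairs.
  If \<open>s\<close> has a member of dimension between \<open>i\<close> and \<open>j\<close>, this bipartite graph is complete; otherwise
  it is the inclusion graph of two layers of an interval \<open>[A, B]\<close> of subspaces.  The averaging
  operator from layer \<open>i\<close> to layer \<open>j\<close> factors through the intermediate layers, and each step
  contracts mean-zero functions by \<open>1 / sqrt q\<close>; hence colours \<open>i\<close> and \<open>j\<close> interact with norm at most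
  \<open>q powr (- \<bar>i - j\<bar> / 2)\<close>.  On functions that are constant on each colour the form is nonpositive
  once the total mean vanishes, and on functions with mean zero on each colour the row sums
  \<open>2 * (\<Sum>k\<ge>1. q powr (- k / 2)) = 2 / (sqrt q - 1)\<close> bound it.\<close>

section \<open>The second eigenvalue of a symmetrizable matrix\<close>

text \<open>\<open>second_eig\<close> is an entry of the sorted list of real roots of a
  characteristic polynomial, so a bound on a quadratic form says nothing until all complex roots are
  known to be real. Self-adjointness for a positive weight gives this, and then control of the form
  on one hyperplane suffices, as in Courant-Fischer. The layers through which averaging factors are
  all dimensions between \<open>i\<close> and \<open>j\<close>, whether or not they lie in
  \<open>S\<close>; hence the decay is in the difference of dimensions. With \<open>[n]\<close> for
  \<open>qnum q n\<close>, the factor \<open>1 / q\<close> of a step bounds the ratio of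
  \<open>[k - a] * ([b - k] - 1)\<close> to \<open>[Suc k - a] * [b - k]\<close>, since
  \<open>q * [k - a] \<le> [Suc k - a]\<close>. Operators are kept unnormalised (sums, not averages)
  so that these numbers stay visible.\<close>

lemma char_poly_splits_if_symmetrizable:
  fixes A :: "real mat" and w :: "nat \<Rightarrow> real"
  assumes A: "A \<in> carrier_mat n n"
    and w: "\<And>i. i < n \<Longrightarrow> w i > 0"
    and sym: "\<And>i j. i < n \<Longrightarrow> j < n \<Longrightarrow> w i * A $$ (i, j) = w j * A $$ (j, i)"
  shows "\<exists>es. char_poly A = (\<Prod>e\<leftarrow>es. [:- e, 1:]) \<and> length es = n"
proof -
  let ?c = "complex_of_real"
  interpret mh: map_poly_inj_idom_hom complex_of_real ..
  let ?A = "map_mat ?c A"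
  have cA: "?A \<in> carrier_mat n n" using A by simp
  obtain as where as: "char_poly ?A = (\<Prod>a\<leftarrow>as. [:- a, 1:])" and len: "length as = n"
    using char_poly_factorized[OF cA] by blast
  have real_root: "?c (Re a) = a" if a: "a \<in> set as" for a
  proof -
    have "poly (char_poly ?A) a = 0"
      unfolding as poly_prod_list using a by (auto simp: prod_list_zero_iff)
    then obtain v where "eigenvector ?A v a"
      using eigenvalue_root_char_poly[OF cA] unfolding eigenvalue_def by blast
    then have v: "v \<in> carrier_vec n" "v \<noteq> 0\<^sub>v n" and ev: "?A *\<^sub>v v = a \<cdot>\<^sub>v v"
      unfolding eigenvector_def using A by auto
    have comp: "(\<Sum>j<n. ?c (A $$ (i, j)) * v $ j) = a * v $ i" if "i < n" for i
    proof -
      have "(?A *\<^sub>v v) $ i = (\<Sum>j<n. ?c (A $$ (i, j)) * v $ j)"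
        using that A v by (simp add: scalar_prod_def lessThan_atLeast0)
      then show ?thesis using ev that v by simp
    qed
    \<comment> \<open>The Hermitian form of \<open>A\<close> at \<open>v\<close>, weighted by
      \<open>w\<close>: it equals \<open>a * r\<close> with \<open>r > 0\<close> and is its own
      conjugate, which forces \<open>a\<close> to be real.\<close>
    define s where "s = (\<Sum>i<n. \<Sum>j<n. ?c (w i * A $$ (i, j)) * cnj (v $ i) * v $ j)"
    define r where "r = (\<Sum>i<n. w i * (cmod (v $ i))\<^sup>2)"
    have "s = (\<Sum>i<n. ?c (w i) * cnj (v $ i) * (\<Sum>j<n. ?c (A $$ (i, j)) * v $ j))"
      unfolding s_def by (simp add: sum_distrib_left mult_ac)
    also have "\<dots> = (\<Sum>i<n. ?c (w i) * cnj (v $ i) * (a * v $ i))"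
      using comp by (intro sum.cong) auto
    also have "\<dots> = a * ?c r"
      unfolding r_def of_real_sum sum_distrib_left
    proof (intro sum.cong refl)
      fix i
      have "v $ i * cnj (v $ i) = ?c ((cmod (v $ i))\<^sup>2)"
        by (metis complex_norm_square of_real_power)
      then show "?c (w i) * cnj (v $ i) * (a * v $ i) = a * ?c (w i * (cmod (v $ i))\<^sup>2)"
        by (simp add: mult_ac)
    qed
    finally have s: "s = a * ?c r" .
    have "cnj s = (\<Sum>i<n. \<Sum>j<n. ?c (w i * A $$ (i, j)) * v $ i * cnj (v $ j))"
      unfolding s_def by simp
    also have "\<dots> = (\<Sum>i<n. \<Sum>j<n. ?c (w j * A $$ (j, i)) * v $ i * cnj (v $ j))"
      using sym by (intro sum.cong) auto
    also have "\<dots> = s" unfolding s_def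
      by (subst sum.swap) (simp add: mult_ac)
    finally have cs: "cnj s = s" .
    obtain k where k: "k < n" "v $ k \<noteq> 0"
      using v by (metis eq_vecI index_zero_vec(1) index_zero_vec(2) carrier_vecD)
    have "r > 0" unfolding r_def
      using k w by (intro sum_pos2[of _ k]) (auto simp: less_imp_le)
    moreover have "cnj a * ?c r = a * ?c r" using cs unfolding s by simp
    ultimately have "cnj a = a" by simp
    then show ?thesis
      by (metis Reals_cnj_iff of_real_Re)
  qed
  define es where "es = map Re as"
  have "map_poly ?c (char_poly A) = char_poly ?A"
    using of_real_hom.char_poly_hom[OF A] by metis
  also have "\<dots> = (\<Prod>a\<leftarrow>as. [:- a, 1:])" by (rule as)
  also have "\<dots> = (\<Prod>a\<leftarrow>as. map_poly ?c [:- Re a, 1:])"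
    using real_root by (intro arg_cong[of _ _ prod_list] map_cong refl) (simp add: of_real_hom.map_poly_pCons_hom)
  also have "\<dots> = map_poly ?c (\<Prod>e\<leftarrow>es. [:- e, 1:])"
    unfolding es_def by (simp add: mh.hom_prod_list o_def)
  finally have "char_poly A = (\<Prod>e\<leftarrow>es. [:- e, 1:])" by simp
  then show ?thesis using len by (intro exI[of _ es]) (simp add: es_def)
qed

lemma proots_linear_factors:
  fixes es :: "'a::idom list"
  shows "proots (\<Prod>e\<leftarrow>es. [:- e, 1:]) = mset es"
proof (induct es)
  case (Cons e es)
  have "(\<Prod>e\<leftarrow>es. [:- e, 1:]) \<noteq> 0"
    by (auto simp: prod_list_zero_iff)
  then show ?case using Cons by (simp add: proots_mult del: mult_pCons_left)
qed auto

text \<open>A Schur form replaces an eigenbasis: its first two columns span an invariant plane on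
  which the form is at least \<open>es ! 1\<close>, and a plane meets every hyperplane in a nonzero
  vector. Repeated roots need no separate treatment.\<close>

lemma second_proot_le:
  fixes A :: "real mat" and w :: "nat \<Rightarrow> real"
  assumes A: "A \<in> carrier_mat n n" and n: "2 \<le> n"
    and w: "\<And>i. i < n \<Longrightarrow> w i > 0"
    and sym: "\<And>i j. i < n \<Longrightarrow> j < n \<Longrightarrow> w i * A $$ (i, j) = w j * A $$ (j, i)"
    and bound: "\<And>x. (\<Sum>i<n. w i * x i) = 0 \<Longrightarrow>
      (\<Sum>i<n. \<Sum>j<n. w i * x i * A $$ (i, j) * x j) \<le> l * (\<Sum>i<n. w i * (x i)\<^sup>2)"
  shows "rev (sorted_list_of_multiset (proots (char_poly A))) ! 1 \<le> l"
proof -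
  obtain es0 where es0: "char_poly A = (\<Prod>e\<leftarrow>es0. [:- e, 1:])" and len0: "length es0 = n"
    using char_poly_splits_if_symmetrizable[OF A w sym] by blast
  define es where "es = rev (sort es0)"
  \<comment> \<open>The linear factors may be listed in decreasing order, so that the Schur form
    shows the two largest roots in its first two diagonal entries.\<close>
  have cp: "char_poly A = (\<Prod>e\<leftarrow>es. [:- e, 1:])"
    unfolding es0 by (subst (1 2) prod_mset_prod_list[symmetric]) (simp add: es_def)
  have len: "length es = n" using len0 es_def by simp
  have es: "rev (sorted_list_of_multiset (proots (char_poly A))) = es"
    unfolding es0 proots_linear_factors es_def by simp
  have e01: "es ! 1 \<le> es ! 0"
    unfolding es_def using n len0 by (auto simp: rev_nth intro!: sorted_nth_mono)
  obtain B P Q where BPQ: "schur_decomposition A es = (B, P, Q)"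
    by (metis prod_cases3)
  have sw: "similar_mat_wit A B P Q" and ut: "upper_triangular B" and dg: "diag_mat B = es"
    using schur_decomposition[OF A cp BPQ] by auto
  have carr: "B \<in> carrier_mat n n" "P \<in> carrier_mat n n" "Q \<in> carrier_mat n n"
    and QP: "Q * P = 1\<^sub>m n" and ABQ: "A = P * B * Q"
    using similar_mat_witD2[OF A sw] by auto
  have AP: "A * P = P * B"
  proof -
    have "A * P = P * B * (Q * P)" unfolding ABQ
      using carr by (simp add: assoc_mult_mat[of _ n n _ n _ n])
    then show ?thesis using carr QP by simp
  qed
  have AP_entry: "(\<Sum>j<n. A $$ (i, j) * P $$ (j, c)) = (\<Sum>j<n. P $$ (i, j) * B $$ (j, c))"
    if "i < n" "c < n" for i c
    using arg_cong[OF AP, of "\<lambda>M. M $$ (i, c)"] that A carr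
    by (simp add: scalar_prod_def lessThan_atLeast0)
  define p where "p i = P $$ (i, 0)" for i
  define r where "r i = P $$ (i, 1)" for i
  define b where "b = B $$ (0, 1)"
  have B0: "B $$ (j, 0) = (if j = 0 then es ! 0 else 0)" if "j < n" for j
    using that ut carr dg n by (auto simp: diag_mat_def upper_triangular_def)
  have B1: "B $$ (j, 1) = (if j = 0 then b else if j = 1 then es ! 1 else 0)" if "j < n" for j
    using that ut carr dg n by (auto simp: diag_mat_def upper_triangular_def b_def)
  have Ap: "(\<Sum>j<n. A $$ (i, j) * p j) = es ! 0 * p i" if "i < n" for i
  proof -
    have "(\<Sum>j<n. P $$ (i, j) * B $$ (j, 0)) = (\<Sum>j<n. if j = 0 then es ! 0 * p i else 0)"
      by (intro sum.cong) (auto simp: B0 p_def)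
    then show ?thesis using AP_entry[OF that, of 0] n by (simp add: p_def)
  qed
  have Ar: "(\<Sum>j<n. A $$ (i, j) * r j) = es ! 1 * r i + b * p i" if "i < n" for i
  proof -
    have "(\<Sum>j<n. P $$ (i, j) * B $$ (j, 1)) =
      (\<Sum>j<n. (if j = 1 then es ! 1 * r i else 0) + (if j = 0 then b * p i else 0))"
      by (intro sum.cong) (auto simp: B1 p_def r_def simp del: One_nat_def)
    also have "\<dots> = es ! 1 * r i + b * p i" using n by (simp add: sum.distrib)
    finally show ?thesis using AP_entry[OF that, of 1] n by (simp add: r_def)
  qed
  have QPe: "(\<Sum>j<n. Q $$ (i, j) * P $$ (j, c)) = (if i = c then 1 else 0)" if "i < n" "c < n" for i c
    using arg_cong[OF QP, of "\<lambda>M. M $$ (i, c)"] that carr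
    by (simp add: scalar_prod_def lessThan_atLeast0)
  have indep: "\<alpha> = 0 \<and> \<beta> = 0" if z: "\<And>i. i < n \<Longrightarrow> \<alpha> * p i + \<beta> * r i = 0" for \<alpha> \<beta>
  proof -
    have "(\<Sum>j<n. Q $$ (i, j) * (\<alpha> * p j + \<beta> * r j)) =
      \<alpha> * (\<Sum>j<n. Q $$ (i, j) * P $$ (j, 0)) + \<beta> * (\<Sum>j<n. Q $$ (i, j) * P $$ (j, 1))" for i
      by (simp add: p_def r_def sum.distrib algebra_simps sum_distrib_left)
    moreover have "(\<Sum>j<n. Q $$ (i, j) * (\<alpha> * p j + \<beta> * r j)) = 0" for i
      using z by simp
    ultimately have *: "\<alpha> * (\<Sum>j<n. Q $$ (i, j) * P $$ (j, 0)) + \<beta> * (\<Sum>j<n. Q $$ (i, j) * P $$ (j, 1)) = 0" for i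
      by metis
    have "\<alpha> = 0" using *[of 0] QPe[of 0 0] QPe[of 0 1] n by simp
    moreover have "\<beta> = 0" using *[of 1] QPe[of 1 0] QPe[of 1 1] n by simp
    ultimately show ?thesis by simp
  qed
  define ip where "ip x y = (\<Sum>i<n. w i * x i * y i)" for x y :: "nat \<Rightarrow> real"
  have ip_comm: "ip x y = ip y x" for x y unfolding ip_def by (simp add: mult_ac)
  have ip_pos: "ip x x > 0" if "i < n" "x i \<noteq> 0" for x i
    unfolding ip_def using that w
    by (intro sum_pos2[of _ i]) (auto simp: less_imp_le mult.assoc zero_less_mult_iff linorder_neq_iff)
  define Ax where "Ax x i = (\<Sum>j<n. A $$ (i, j) * x j)" for x i
  have ipA: "ip x (Ax y) = (\<Sum>i<n. \<Sum>j<n. w i * x i * A $$ (i, j) * y j)" for x y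
    unfolding ip_def Ax_def by (simp add: sum_distrib_left mult_ac)
  have ipA_sym: "ip x (Ax y) = ip y (Ax x)" for x y
  proof -
    have "ip x (Ax y) = (\<Sum>i<n. \<Sum>j<n. w j * A $$ (j, i) * x i * y j)"
      unfolding ipA
    proof (intro sum.cong refl)
      fix i j assume "i \<in> {..<n}" "j \<in> {..<n}"
      then show "w i * x i * A $$ (i, j) * y j = w j * A $$ (j, i) * x i * y j"
        using sym[of i j] by simp
    qed
    also have "\<dots> = ip y (Ax x)" unfolding ipA
      by (subst sum.swap) (simp add: mult_ac)
    finally show ?thesis .
  qed
  have ip_lin: "ip x (\<lambda>i. c * y i + d * z i) = c * ip x y + d * ip x z" for x y z c d
    unfolding ip_def by (simp add: algebra_simps sum.distrib sum_distrib_left)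
  have ip_Ap: "ip x (Ax p) = es ! 0 * ip x p" for x
    unfolding ip_def sum_distrib_left by (intro sum.cong) (auto simp: Ax_def Ap)
  have ip_Ar: "ip x (Ax r) = es ! 1 * ip x r + b * ip x p" for x
    unfolding ip_def sum_distrib_left sum.distrib[symmetric] by (intro sum.cong refl, simp add: Ax_def Ar, simp add: algebra_simps)
  have pp: "ip p p > 0"
    using indep[of 1 0] ip_pos by fastforce
  \<comment> \<open>Self-adjointness fixes the off-diagonal Schur entry \<open>b\<close> in terms of
    \<open>ip p r\<close>, so neither orthogonality of \<open>p\<close> and \<open>r\<close> nor
    diagonalizability has to be arranged.\<close>
  have b: "b * ip p p = (es ! 0 - es ! 1) * ip p r"
    using ipA_sym[of p r] unfolding ip_Ap ip_Ar by (simp add: algebra_simps ip_comm)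
  \<comment> \<open>If both leading eigenvalues exceeded \<open>l\<close>, the invariant plane spanned by \<open>p\<close> and \<open>r\<close>
    would meet the weighted mean-zero hyperplane in a vector violating the bound.\<close>
  show ?thesis unfolding es
  proof (rule ccontr)
    assume "\<not> es ! 1 \<le> l"
    then have gt: "es ! 1 > l" by simp
    define W where "W x = (\<Sum>i<n. w i * x i)" for x
    obtain \<alpha> \<beta> where ab: "\<alpha> \<noteq> 0 \<or> \<beta> \<noteq> 0" and Wab: "\<alpha> * W p + \<beta> * W r = 0"
    proof (cases "W p = 0 \<and> W r = 0")
      case True then show thesis using that[of 1 0] by simp
    next
      case False then show thesis using that[of "W r" "- W p"] by auto
    qed
    define x where "x i = \<alpha> * p i + \<beta> * r i" for i
    have x_eq: "x = (\<lambda>i. \<alpha> * p i + \<beta> * r i)" by (simp add: x_def fun_eq_iff)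
    have "(\<Sum>i<n. w i * x i) = \<alpha> * W p + \<beta> * W r"
      unfolding W_def x_def by (simp add: algebra_simps sum.distrib sum_distrib_left)
    then have le: "ip x (Ax x) \<le> l * ip x x"
      using bound[of x] Wab unfolding ipA unfolding ip_def by (simp add: power2_eq_square mult_ac)
    have "\<exists>k<n. x k \<noteq> 0"
    proof (rule ccontr)
      assume "\<not> (\<exists>k<n. x k \<noteq> 0)"
      then have "\<alpha> * p i + \<beta> * r i = 0" if "i < n" for i using that by (simp add: x_def)
      then show False using indep ab by blast
    qed
    then obtain k where "k < n" "x k \<noteq> 0" by blast
    then have xx: "ip x x > 0" by (rule ip_pos)
    have ipxx: "ip x x = \<alpha>\<^sup>2 * ip p p + 2 * \<alpha> * \<beta> * ip p r + \<beta>\<^sup>2 * ip r r"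
    proof -
      have "ip x x = \<alpha> * ip x p + \<beta> * ip x r" by (subst (2) x_eq) (rule ip_lin)
      also have "ip x p = \<alpha> * ip p p + \<beta> * ip p r"
        by (subst ip_comm, subst x_eq) (rule ip_lin)
      also have "ip x r = \<alpha> * ip p r + \<beta> * ip r r"
        by (subst ip_comm, subst x_eq) (simp add: ip_lin ip_comm[of r p])
      finally show ?thesis by (simp add: algebra_simps power2_eq_square)
    qed
    have "Ax x = (\<lambda>i. \<alpha> * Ax p i + \<beta> * Ax r i)"
      unfolding Ax_def x_def by (simp add: fun_eq_iff algebra_simps sum.distrib sum_distrib_left)
    then have "ip x (Ax x) = \<alpha> * ip x (Ax p) + \<beta> * ip x (Ax r)" by (simp add: ip_lin)
    also have "\<dots> = \<alpha> * (es ! 0 * ip p x) + \<beta> * (es ! 1 * ip r x + b * ip p x)"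
      unfolding ip_Ap ip_Ar by (simp add: ip_comm[of x])
    also have "ip p x = \<alpha> * ip p p + \<beta> * ip p r" unfolding x_eq by (rule ip_lin)
    also have "ip r x = \<alpha> * ip p r + \<beta> * ip r r" unfolding x_eq by (simp add: ip_lin ip_comm[of r p])
    \<comment> \<open>Scaled by \<open>ip p p\<close>, the excess over \<open>es ! 1\<close> becomes
      \<open>es ! 0 - es ! 1\<close> times a perfect square; the decreasing order of
      \<open>es\<close> enters here.\<close>
    finally have "ip x (Ax x) * ip p p - es ! 1 * ip x x * ip p p
      = (es ! 0 - es ! 1) * ip p p * (\<alpha>\<^sup>2 * ip p p + \<alpha> * \<beta> * ip p r)
        + \<beta> * (b * ip p p) * (\<alpha> * ip p p + \<beta> * ip p r)"
      unfolding ipxx by (simp add: algebra_simps power2_eq_square)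
    also have "\<dots> = (es ! 0 - es ! 1) * (\<alpha> * ip p p + \<beta> * ip p r)\<^sup>2"
      unfolding b by (simp add: algebra_simps power2_eq_square)
    also have "\<dots> \<ge> 0" using e01 by simp
    finally have "es ! 1 * ip x x \<le> ip x (Ax x)" using pp
      by (metis diff_ge_0_iff_ge mult_le_cancel_right_pos)
    moreover have "l * ip x x < es ! 1 * ip x x" using gt xx by simp
    ultimately show False using le by linarith
  qed
qed

text \<open>Any hyperplane will do in the variational bound, so \<open>w\<close> is free to be any
  positive weight that symmetrizes \<open>M\<close>. The assumptions speak of functions on
  \<open>V\<close> and therefore apply to whichever enumeration \<open>enum_of\<close>
  picks.\<close>

theorem second_eig_le:
  fixes w :: "'v \<Rightarrow> real"
  assumes V: "finite V" "2 \<le> card V"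
    and w: "\<And>v. v \<in> V \<Longrightarrow> w v > 0"
    and sym: "\<And>u v. u \<in> V \<Longrightarrow> v \<in> V \<Longrightarrow> w u * M u v = w v * M v u"
    and bound: "\<And>f. (\<Sum>v\<in>V. w v * f v) = 0 \<Longrightarrow>
      (\<Sum>v\<in>V. \<Sum>u\<in>V. w v * f v * M v u * f u) \<le> l * (\<Sum>v\<in>V. w v * (f v)\<^sup>2)"
  shows "second_eig V M \<le> l"
proof -
  define xs where "xs = enum_of V"
  have "distinct xs \<and> set xs = V"
    unfolding xs_def enum_of_def using finite_distinct_list[OF V(1)] by (metis (mono_tags, lifting) someI_ex)
  then have xs: "distinct xs" "set xs = V" by auto
  define n where "n = length xs"
  have cV: "card V = n" using xs distinct_card n_def by fastforce
  have bij: "bij_betw (\<lambda>i. xs ! i) {..<n} V"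
    using bij_betw_nth[OF xs(1)] xs(2) n_def by blast
  have inV: "xs ! i \<in> V" if "i < n" for i using that xs n_def by auto
  have re: "(\<Sum>v\<in>V. g v) = (\<Sum>i<n. g (xs ! i))" for g :: "'v \<Rightarrow> real"
    by (rule sum.reindex_bij_betw[OF bij, symmetric])
  define A where "A = mat n n (\<lambda>(i, j). M (xs ! i) (xs ! j))"
  have opm: "op_matrix V M = A"
    unfolding op_matrix_def A_def n_def xs_def by (simp add: Let_def)
  have A: "A \<in> carrier_mat n n" unfolding A_def by simp
  have entry: "A $$ (i, j) = M (xs ! i) (xs ! j)" if "i < n" "j < n" for i j
    using that unfolding A_def by simp
  show ?thesis
    unfolding second_eig_def eigenvalues_desc_def opm
  proof (rule second_proot_le[OF A, where w = "\<lambda>i. w (xs ! i)"])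
    show "2 \<le> n" using V cV by simp
    show "w (xs ! i) > 0" if "i < n" for i using w inV that by blast
    show "w (xs ! i) * A $$ (i, j) = w (xs ! j) * A $$ (j, i)" if "i < n" "j < n" for i j
      using that entry sym inV by simp
    fix x assume x: "(\<Sum>i<n. w (xs ! i) * x i) = 0"
    define f where "f v = x (the_inv_into {..<n} (\<lambda>i. xs ! i) v)" for v
    have f: "f (xs ! i) = x i" if "i < n" for i
      unfolding f_def using that bij by (simp add: bij_betw_def the_inv_into_f_f)
    show "(\<Sum>i<n. \<Sum>j<n. w (xs ! i) * x i * A $$ (i, j) * x j) \<le> l * (\<Sum>i<n. w (xs ! i) * (x i)\<^sup>2)"
      using bound[of f] x unfolding re by (simp add: f entry)
  qed
qed

section \<open>Counting subspaces in an interval\<close>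

lemma sum_fun_apply_pointwise: "(\<Sum>x\<in>X. f x) i = (\<Sum>x\<in>X. f x i :: 'b::comm_monoid_add)"
  by (induct X rule: infinite_finite_induct) auto

definition unit_fun :: "'n \<Rightarrow> 'n \<Rightarrow> 'a::field" where
  "unit_fun i = (\<lambda>j. if j = i then 1 else 0)"

lemma vector_space_vscale: "vector_space (vscale :: 'a::field \<Rightarrow> ('n \<Rightarrow> 'a) \<Rightarrow> _)"
  by unfold_locales (auto simp: vscale_def algebra_simps fun_eq_iff)

lemma unit_fun_inj: "inj (unit_fun :: 'n \<Rightarrow> 'n \<Rightarrow> 'a::field)"
  unfolding unit_fun_def by (rule injI) (metis zero_neq_one)

text \<open>Places the raw constants behind \<open>is_subspace\<close> and \<open>sdim\<close>
  within finite-dimensional linear algebra; with the coordinate functions as basis the whole space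
  gets dimension \<open>CARD('n)\<close>.\<close>

interpretation fvs: finite_dimensional_vector_space
  "vscale :: 'a::field \<Rightarrow> ('n::finite \<Rightarrow> 'a) \<Rightarrow> _" "range unit_fun"
proof -
  interpret v: vector_space "vscale :: 'a::field \<Rightarrow> ('n \<Rightarrow> 'a) \<Rightarrow> _"
    by (rule vector_space_vscale)
  have comb: "(\<Sum>v\<in>range unit_fun. vscale (u v) v) = (\<lambda>i. u (unit_fun i))"
    for u :: "('n \<Rightarrow> 'a) \<Rightarrow> 'a"
  proof
    fix i
    have "(\<Sum>v\<in>range unit_fun. vscale (u v) v) i = (\<Sum>j\<in>UNIV. u (unit_fun j) * unit_fun j i)"
      by (simp add: sum.reindex[OF unit_fun_inj] sum_fun_apply_pointwise vscale_def)
    also have "\<dots> = (\<Sum>j\<in>UNIV. if j = i then u (unit_fun j) else 0)"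
      by (intro sum.cong) (auto simp: unit_fun_def)
    finally show "(\<Sum>v\<in>range unit_fun. vscale (u v) v) i = u (unit_fun i)" by simp
  qed
  show "finite_dimensional_vector_space (vscale :: 'a \<Rightarrow> ('n \<Rightarrow> 'a) \<Rightarrow> _) (range unit_fun)"
  proof unfold_locales
    show "finite (range (unit_fun :: 'n \<Rightarrow> 'n \<Rightarrow> 'a))" by simp
    show "\<not> v.dependent (range unit_fun)"
      by (auto simp: v.dependent_finite comb fun_eq_iff)
    show "v.span (range unit_fun) = UNIV"
    proof -
      have "f \<in> v.span (range unit_fun)" for f :: "'n \<Rightarrow> 'a"
      proof -
        have "f = (\<Sum>v\<in>range unit_fun. vscale (f (the_inv unit_fun v)) v)"
          unfolding comb by (simp add: the_inv_f_f[OF unit_fun_inj])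
        then show ?thesis
          by (metis (no_types, lifting) v.span_base v.span_scale v.span_sum)
      qed
      then show ?thesis by blast
    qed
  qed
qed

lemma is_subspace_iff: "is_subspace W \<longleftrightarrow> fvs.subspace W"
  unfolding is_subspace_def ..

lemma sdim_eq_dim: "sdim W = fvs.dim W"
  unfolding sdim_def ..

lemma sdim_UNIV: "sdim (UNIV :: ('n::finite \<Rightarrow> 'a::field) set) = CARD('n)"
  unfolding sdim_eq_dim by (simp add: card_image unit_fun_inj)

lemma sdim_mono: "U \<subseteq> W \<Longrightarrow> sdim U \<le> sdim (W :: ('n::finite \<Rightarrow> 'a::field) set)"
  unfolding sdim_eq_dim by (rule fvs.dim_subset)

lemma subspace_eqI:
  fixes U W :: "('n::finite \<Rightarrow> 'a::field) set"
  assumes "is_subspace U" "is_subspace W" "U \<subseteq> W" "sdim W \<le> sdim U"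
  shows "U = W"
  using assms fvs.subspace_dim_equal unfolding is_subspace_iff sdim_eq_dim by blast

lemma card_field_ge_2: "2 \<le> CARD('a::{field,finite})"
proof -
  have "card {0, 1 :: 'a} \<le> CARD('a)" by (rule card_mono) auto
  then show ?thesis by simp
qed

text \<open>Adjoining an independent \<open>b\<close> multiplies the size by that of the field:
  \<open>(k, y)\<close> goes to \<open>y + vscale k b\<close> bijectively, since two representations
  with different \<open>k\<close> would put \<open>b\<close> into the span.\<close>

lemma card_span_independent:
  fixes B :: "('n::finite \<Rightarrow> 'a::{field,finite}) set"
  assumes "\<not> fvs.dependent B"
  shows "card (fvs.span B) = CARD('a) ^ card B"
proof -
  have "finite B" by simp
  then show ?thesis using assms
  proof (induct B)
    case (insert b B)
    then have ind: "\<not> fvs.dependent B" and b: "b \<notin> fvs.span B"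
      by (auto simp: fvs.independent_insert)
    let ?g = "\<lambda>(k, y). y + vscale k b"
    have "inj_on ?g (UNIV \<times> fvs.span B)"
    proof (rule inj_onI, clarify)
      fix k y k' y' assume y: "y \<in> fvs.span B" "y' \<in> fvs.span B"
        and eq: "y + vscale k b = y' + vscale k' b"
      have "k = k'"
      proof (rule ccontr)
        assume "k \<noteq> k'"
        have "vscale (k - k') b = y' - y" using eq
          by (simp add: fvs.scale_left_diff_distrib algebra_simps)
        then have "vscale (inverse (k - k')) (vscale (k - k') b) \<in> fvs.span B"
          using y by (simp add: fvs.span_diff fvs.span_scale del: fvs.scale_scale)
        then show False using \<open>k \<noteq> k'\<close> b by simp
      qed
      then show "k = k' \<and> y = y'" using eq by simp
    qed
    moreover have "?g ` (UNIV \<times> fvs.span B) = fvs.span (insert b B)"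
    proof -
      have "x \<in> ?g ` (UNIV \<times> fvs.span B) \<longleftrightarrow> (\<exists>k. x - vscale k b \<in> fvs.span B)" for x
      proof
        assume "\<exists>k. x - vscale k b \<in> fvs.span B"
        then obtain k where "x - vscale k b \<in> fvs.span B" ..
        then show "x \<in> ?g ` (UNIV \<times> fvs.span B)"
          by (intro image_eqI[of _ _ "(k, x - vscale k b)"]) auto
      next
        assume "x \<in> ?g ` (UNIV \<times> fvs.span B)"
        then obtain k y where "x = y + vscale k b" "y \<in> fvs.span B" by auto
        then show "\<exists>k. x - vscale k b \<in> fvs.span B" by (intro exI[of _ k]) simp
      qed
      then show ?thesis unfolding fvs.span_insert by blast
    qed
    ultimately have "card (fvs.span (insert b B)) = card (UNIV \<times> fvs.span B :: ('a \<times> _) set)"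
      by (metis card_image)
    then show ?case using insert ind by (simp add: card_cartesian_product)
  qed simp
qed

lemma card_subspace:
  fixes W :: "('n::finite \<Rightarrow> 'a::{field,finite}) set"
  assumes "is_subspace W"
  shows "card W = CARD('a) ^ sdim W"
proof -
  obtain B where B: "B \<subseteq> W" "\<not> fvs.dependent B" "W \<subseteq> fvs.span B" "card B = fvs.dim W"
    by (rule fvs.basis_exists)
  then have "fvs.span B = W"
    using assms fvs.span_subspace unfolding is_subspace_iff by blast
  then show ?thesis using card_span_independent[OF B(2)] B(4) unfolding sdim_eq_dim by simp
qed

text \<open>The Gaussian integer \<open>[n]\<close>, the number of lines in an
  \<open>n\<close>-dimensional space over the field with \<open>q\<close> elements.\<close>

definition qnum :: "real \<Rightarrow> nat \<Rightarrow> real" where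
  "qnum q n = (q ^ n - 1) / (q - 1)"

text \<open>The Gaussian binomial coefficient. Over the reals this recursion asks for no
  divisibility, and it is the one that the double count in \<open>card_layer\<close>
  produces.\<close>

fun gauss_binomial :: "real \<Rightarrow> nat \<Rightarrow> nat \<Rightarrow> real" where
  "gauss_binomial q n 0 = 1"
| "gauss_binomial q n (Suc m) = qnum q n / qnum q (Suc m) * gauss_binomial q (n - 1) m"

lemma qnum_0 [simp]: "qnum q 0 = 0"
  by (simp add: qnum_def)

lemma qnum_Suc: "q \<noteq> 1 \<Longrightarrow> qnum q (Suc n) = q * qnum q n + 1"
  by (simp add: qnum_def divide_simps) (simp add: algebra_simps)

lemma qnum_nonneg: "1 < q \<Longrightarrow> 0 \<le> qnum q n"
  by (simp add: qnum_def)

lemma qnum_ge_1: "1 < q \<Longrightarrow> 0 < n \<Longrightarrow> 1 \<le> qnum q n"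
  by (cases n) (auto simp: qnum_Suc qnum_nonneg)

lemma qnum_pos: "1 < q \<Longrightarrow> 0 < n \<Longrightarrow> 0 < qnum q n"
  by (drule (1) qnum_ge_1) linarith

lemma gauss_binomial_pos: "1 < q \<Longrightarrow> m \<le> n \<Longrightarrow> 0 < gauss_binomial q n m"
  by (induct m arbitrary: n) (auto simp: qnum_pos)

lemma gauss_binomial_codim_1: "1 < q \<Longrightarrow> gauss_binomial q (Suc n) n = qnum q (Suc n)"
proof (induct n)
  case 0 then show ?case by (simp add: qnum_Suc)
next
  case (Suc n) then show ?case using qnum_pos[of q "Suc n"] by simp
qed

definition layer :: "('n \<Rightarrow> 'a::field) set \<Rightarrow> ('n \<Rightarrow> 'a) set \<Rightarrow> nat \<Rightarrow> ('n \<Rightarrow> 'a) set set" where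
  "layer A B k = {U. is_subspace U \<and> A \<subseteq> U \<and> U \<subseteq> B \<and> sdim U = k}"

lemma layer_low:
  fixes A B :: "('n::finite \<Rightarrow> 'a::field) set"
  assumes "is_subspace A" "A \<subseteq> B"
  shows "layer A B (sdim A) = {A}"
proof (intro equalityI subsetI)
  fix U assume "U \<in> layer A B (sdim A)"
  then have "A = U" using assms by (intro subspace_eqI) (auto simp: layer_def)
  then show "U \<in> {A}" by simp
qed (use assms in \<open>simp add: layer_def\<close>)

text \<open>An atom is generated over \<open>A\<close> by any of its vectors outside
  \<open>A\<close>, so the sets \<open>U - A\<close> partition \<open>B - A\<close>; each has
  \<open>q ^ Suc (sdim A) - q ^ sdim A\<close> elements.\<close>

lemma card_layer_atoms:
  fixes A B :: "('n::finite \<Rightarrow> 'a::{field,finite}) set"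
  assumes A: "is_subspace A" and B: "is_subspace B" and AB: "A \<subseteq> B"
  shows "real (card (layer A B (Suc (sdim A)))) = qnum (real CARD('a)) (sdim B - sdim A)"
proof -
  let ?L = "layer A B (Suc (sdim A))" and ?q = "CARD('a)"
  define ext where "ext x = fvs.span (insert x A)" for x
  have ext: "ext x \<in> ?L \<and> x \<in> ext x" if x: "x \<in> B - A" for x
  proof -
    have "x \<notin> fvs.span A" using x A by (simp add: fvs.span_eq_iff[THEN iffD2] is_subspace_iff)
    moreover have "ext x \<subseteq> B" unfolding ext_def
      using x AB B by (intro fvs.span_minimal) (auto simp: is_subspace_iff)
    moreover have "A \<subseteq> ext x" "x \<in> ext x"
      unfolding ext_def using fvs.span_superset by fastforce+
    ultimately show ?thesis
      by (simp add: layer_def ext_def is_subspace_iff sdim_eq_dim fvs.dim_insert)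
  qed
  have ext_unique: "U = ext x" if U: "U \<in> ?L" and x: "x \<in> U - A" for U x
  proof -
    have U': "is_subspace U" "A \<subseteq> U" "U \<subseteq> B" "sdim U = Suc (sdim A)"
      using U by (auto simp: layer_def)
    have "x \<in> B - A" using U' x by auto
    then have "ext x \<in> ?L" using ext by blast
    moreover have "ext x \<subseteq> U" unfolding ext_def
      using x U' by (intro fvs.span_minimal) (auto simp: is_subspace_iff)
    ultimately show ?thesis using subspace_eqI[of "ext x" U] U' by (auto simp: layer_def)
  qed
  have cover: "B - A = (\<Union>U\<in>?L. U - A)"
  proof (intro equalityI subsetI)
    fix x assume "x \<in> B - A"
    then show "x \<in> (\<Union>U\<in>?L. U - A)" using ext[of x] by blast
  qed (auto simp: layer_def)
  have "card (B - A) = (\<Sum>U\<in>?L. card (U - A))"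
    unfolding cover
  proof (rule card_UN_disjoint)
    show "\<forall>U\<in>?L. \<forall>U'\<in>?L. U \<noteq> U' \<longrightarrow> (U - A) \<inter> (U' - A) = {}"
      using ext_unique by blast
  qed auto
  also have "\<dots> = (\<Sum>U\<in>?L. ?q ^ Suc (sdim A) - ?q ^ sdim A)"
    using A by (intro sum.cong refl) (auto simp: layer_def card_Diff_subset card_subspace)
  also have "card (B - A) = ?q ^ sdim B - ?q ^ sdim A"
    using A B AB by (simp add: card_Diff_subset card_subspace)
  finally have eq: "?q ^ sdim B - ?q ^ sdim A = card ?L * (?q ^ Suc (sdim A) - ?q ^ sdim A)" by simp
  have q2: "2 \<le> ?q" by (rule card_field_ge_2)
  have le: "sdim A \<le> sdim B" using AB by (rule sdim_mono)
  have "real ?q ^ sdim B - real ?q ^ sdim A = card ?L * (real ?q ^ Suc (sdim A) - real ?q ^ sdim A)"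
    using arg_cong[OF eq, of real] le q2 by (simp add: of_nat_diff power_increasing)
  moreover have "real ?q ^ sdim B = real ?q ^ sdim A * real ?q ^ (sdim B - sdim A)"
    using le by (simp flip: power_add)
  ultimately have "real ?q ^ sdim A * (real ?q ^ (sdim B - sdim A) - 1)
      = real ?q ^ sdim A * (card ?L * (real ?q - 1))"
    by (simp add: algebra_simps)
  then have "real ?q ^ (sdim B - sdim A) - 1 = card ?L * (real ?q - 1)"
    using q2 by simp
  then show ?thesis using q2 by (simp add: qnum_def)
qed

lemma sum_card_swap:
  assumes "finite X" "finite Y"
  shows "(\<Sum>x\<in>X. real (card {y \<in> Y. R x y})) = (\<Sum>y\<in>Y. real (card {x \<in> X. R x y}))"
  using sum.swap_restrict[OF assms, of "\<lambda>_ _. 1::real" R] by simp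

text \<open>Pairs of an atom \<open>V\<close> over \<open>A\<close> and a
  \<open>k\<close>-dimensional \<open>U\<close> above it are counted in two ways. Over a fixed
  \<open>V\<close> the induction hypothesis applies with \<open>V\<close> in place of
  \<open>A\<close>, which gives the recursion of \<open>gauss_binomial\<close>.\<close>

theorem card_layer:
  fixes A B :: "('n::finite \<Rightarrow> 'a::{field,finite}) set"
  assumes "is_subspace A" "is_subspace B" "A \<subseteq> B" "sdim A \<le> k" "k \<le> sdim B"
  shows "real (card (layer A B k)) = gauss_binomial (real CARD('a)) (sdim B - sdim A) (k - sdim A)"
  using assms
proof (induct "k - sdim A" arbitrary: A)
  case 0
  then have "k = sdim A" by simp
  then show ?case using 0 layer_low[of A B] by simp
next
  case (Suc m)
  let ?q = "real CARD('a)" and ?a = "sdim A" and ?b = "sdim B"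
  have q: "1 < ?q" using card_field_ge_2[where 'a='a] by linarith
  have km: "k - ?a = Suc m" using Suc by simp
  have up: "real (card {U \<in> layer A B k. V \<subseteq> U}) = gauss_binomial ?q (?b - ?a - 1) m"
    if V: "V \<in> layer A B (Suc ?a)" for V
  proof -
    have "{U \<in> layer A B k. V \<subseteq> U} = layer V B k" using V by (auto simp: layer_def)
    moreover have "real (card (layer V B k)) = gauss_binomial ?q (?b - sdim V) (k - sdim V)"
      using V Suc by (intro Suc(1)) (auto simp: layer_def)
    moreover have "k - Suc ?a = m" using km by simp
    ultimately show ?thesis using V by (auto simp: layer_def)
  qed
  have down: "real (card {V \<in> layer A B (Suc ?a). V \<subseteq> U}) = qnum ?q (Suc m)"
    if U: "U \<in> layer A B k" for U
  proof -
    have "{V \<in> layer A B (Suc ?a). V \<subseteq> U} = layer A U (Suc ?a)" using U by (auto simp: layer_def)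
    then show ?thesis using card_layer_atoms[of A U] U Suc by (auto simp: layer_def)
  qed
  have "(\<Sum>U\<in>layer A B k. real (card {V \<in> layer A B (Suc ?a). V \<subseteq> U})) =
    (\<Sum>V\<in>layer A B (Suc ?a). real (card {U \<in> layer A B k. V \<subseteq> U}))"
    by (rule sum_card_swap) auto
  then have "real (card (layer A B k)) * qnum ?q (Suc m)
      = qnum ?q (?b - ?a) * gauss_binomial ?q (?b - ?a - 1) m"
    using card_layer_atoms[of A B] Suc by (simp add: up down)
  then show ?case using qnum_pos[OF q, of "Suc m"] km by (simp add: field_simps)
qed

section \<open>Inclusion operators between layers\<close>

text \<open>A common cover can only be the sum of \<open>U\<close> and \<open>U'\<close>, a common
  cocover only their intersection. Their dimensions add up to \<open>2 * k\<close>, so one has the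
  right dimension exactly if the other has. As \<open>U\<close> and \<open>U'\<close> differ,
  \<open>k\<close> is positive and \<open>k - 1\<close> is not truncated.\<close>

lemma common_cover_iff_common_cocover:
  fixes U U' :: "('n::finite \<Rightarrow> 'a::{field,finite}) set"
  assumes U: "U \<in> layer A B k" and U': "U' \<in> layer A B k" and ne: "U \<noteq> U'"
    and B: "is_subspace B"
  shows "card {W \<in> layer A B (Suc k). U \<subseteq> W \<and> U' \<subseteq> W} = card {V \<in> layer A B (k - 1). V \<subseteq> U \<and> V \<subseteq> U'}"
proof -
  define S where "S = {x + y |x y. x \<in> U \<and> y \<in> U'}"
  let ?I = "U \<inter> U'"
  note defs = is_subspace_iff sdim_eq_dim
  have sub: "is_subspace U" "is_subspace U'" and dim: "sdim U = k" "sdim U' = k"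
    using U U' by (auto simp: layer_def)
  have S: "is_subspace S" and I: "is_subspace ?I"
    using sub fvs.subspace_sums fvs.subspace_inter unfolding S_def defs by blast+
  have sum: "sdim S + sdim ?I = 2 * k"
    using fvs.dim_sums_Int[of U U'] sub dim unfolding S_def defs by simp
  have S_least: "S \<subseteq> W" if "is_subspace W" "U \<subseteq> W" "U' \<subseteq> W" for W
    using that fvs.subspace_add unfolding S_def defs by blast
  have US: "U \<subseteq> S" "U' \<subseteq> S"
  proof -
    have "0 \<in> U" "0 \<in> U'" using sub fvs.subspace_0 unfolding defs by blast+
    then have "x \<in> U \<Longrightarrow> x \<in> S" "x \<in> U' \<Longrightarrow> x \<in> S" for x
      unfolding S_def by (auto intro: exI[of _ x] exI[of _ 0])
    then show "U \<subseteq> S" "U' \<subseteq> S" by auto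
  qed
  have "sdim ?I \<noteq> k"
  proof
    assume "sdim ?I = k"
    then have "?I = U" "?I = U'"
      using subspace_eqI[OF I sub(1)] subspace_eqI[OF I sub(2)] dim by auto
    then show False using ne by simp
  qed
  moreover have "sdim ?I \<le> k" using sdim_mono[of ?I U] dim by simp
  ultimately have Ik: "sdim ?I < k" by simp
  have "{W \<in> layer A B (Suc k). U \<subseteq> W \<and> U' \<subseteq> W} = (if sdim S = Suc k then {S} else {})"
  proof -
    have "W = S \<and> sdim S = Suc k" if W: "W \<in> layer A B (Suc k)" "U \<subseteq> W" "U' \<subseteq> W" for W
    proof -
      have SW: "S \<subseteq> W" and Wk: "is_subspace W" "sdim W = Suc k"
        using W S_least by (auto simp: layer_def)
      have "Suc k \<le> sdim S" using sum Ik by simp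
      then show ?thesis using subspace_eqI[OF S Wk(1) SW] Wk by simp
    qed
    moreover have "S \<in> layer A B (Suc k)" if "sdim S = Suc k"
      using that S US U U' B S_least[of B] by (auto simp: layer_def)
    ultimately show ?thesis using US by auto
  qed
  moreover have "{V \<in> layer A B (k - 1). V \<subseteq> U \<and> V \<subseteq> U'} = (if sdim ?I = k - 1 then {?I} else {})"
  proof -
    have "V = ?I \<and> sdim ?I = k - 1" if V: "V \<in> layer A B (k - 1)" "V \<subseteq> U" "V \<subseteq> U'" for V
    proof -
      have VI: "V \<subseteq> ?I" and Vk: "is_subspace V" "sdim V = k - 1"
        using V by (auto simp: layer_def)
      then show ?thesis using subspace_eqI[OF Vk(1) I VI] Ik by auto
    qed
    moreover have "?I \<in> layer A B (k - 1)" if "sdim ?I = k - 1"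
      using that I U U' by (auto simp: layer_def)
    ultimately show ?thesis by auto
  qed
  moreover have "sdim S = Suc k \<longleftrightarrow> sdim ?I = k - 1" using sum Ik by auto
  ultimately show ?thesis by simp
qed

text \<open>Rewrites the squared norm of an image under an incidence matrix as its Gram form, in
  which numbers of common neighbours can be compared.\<close>

lemma sum_square_incidence:
  fixes f :: "'u \<Rightarrow> real"
  assumes "finite X" "finite Y"
  shows "(\<Sum>w\<in>Y. (\<Sum>x | x \<in> X \<and> R x w. f x)\<^sup>2) =
    (\<Sum>x\<in>X. \<Sum>y\<in>X. f x * f y * card {w \<in> Y. R x w \<and> R y w})"
proof -
  have "(\<Sum>w\<in>Y. (\<Sum>x | x \<in> X \<and> R x w. f x)\<^sup>2)
      = (\<Sum>w\<in>Y. \<Sum>x\<in>X. \<Sum>y\<in>X. if R x w \<and> R y w then f x * f y else 0)"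
  proof (intro sum.cong refl)
    fix w
    have "(\<Sum>x | x \<in> X \<and> R x w. f x) = (\<Sum>x\<in>X. if R x w then f x else 0)"
      using assms by (simp add: sum.inter_filter)
    then show "(\<Sum>x | x \<in> X \<and> R x w. f x)\<^sup>2 = (\<Sum>x\<in>X. \<Sum>y\<in>X. if R x w \<and> R y w then f x * f y else 0)"
      by (simp only: power2_eq_square sum_product) (intro sum.cong refl, auto)
  qed
  also have "\<dots> = (\<Sum>x\<in>X. \<Sum>y\<in>X. \<Sum>w\<in>Y. if R x w \<and> R y w then f x * f y else 0)"
    by (subst sum.swap) (intro sum.cong refl sum.swap)
  also have "\<dots> = (\<Sum>x\<in>X. \<Sum>y\<in>X. f x * f y * card {w \<in> Y. R x w \<and> R y w})"
    using assms by (intro sum.cong refl) (simp flip: sum.inter_filter)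
  finally show ?thesis .
qed

section \<open>Incidence operators in a fixed interval of subspaces\<close>

locale subspace_interval =
  fixes A B :: "('n::finite \<Rightarrow> 'a::{field,finite}) set" and q :: real
  assumes A: "is_subspace A" and B: "is_subspace B" and AB: "A \<subseteq> B"
    and q: "q = real CARD('a)"
begin

abbreviation (input) "a \<equiv> sdim A"
abbreviation (input) "b \<equiv> sdim B"
abbreviation (input) "L \<equiv> layer A B"

lemma q_gt_1: "1 < q"
  using card_field_ge_2[where 'a='a] q by linarith

lemma layer_below: "W \<in> L j \<Longrightarrow> {U \<in> L i. U \<subseteq> W} = layer A W i"
  by (auto simp: layer_def)

lemma layer_below_same:
  assumes "W \<in> L i"
  shows "{U \<in> L i. U \<subseteq> W} = {W}"
proof (intro equalityI subsetI)
  fix U assume "U \<in> {U \<in> L i. U \<subseteq> W}"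
  then have "U = W" using assms by (intro subspace_eqI) (auto simp: layer_def)
  then show "U \<in> {W}" by simp
qed (use assms in auto)

lemma layer_above: "U \<in> L i \<Longrightarrow> {W \<in> L j. U \<subseteq> W} = layer U B j"
  by (auto simp: layer_def)

lemma card_below:
  "W \<in> L j \<Longrightarrow> a \<le> i \<Longrightarrow> i \<le> j \<Longrightarrow> real (card {U \<in> L i. U \<subseteq> W}) = gauss_binomial q (j - a) (i - a)"
  unfolding layer_below using card_layer[of A W i, folded q] A by (auto simp: layer_def)

lemma card_above:
  "U \<in> L i \<Longrightarrow> i \<le> j \<Longrightarrow> j \<le> b \<Longrightarrow> real (card {W \<in> L j. U \<subseteq> W}) = gauss_binomial q (b - i) (j - i)"
  unfolding layer_above using card_layer[of U B j, folded q] B by (auto simp: layer_def)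

lemma card_above_Suc: "U \<in> L k \<Longrightarrow> real (card {W \<in> L (Suc k). U \<subseteq> W}) = qnum q (b - k)"
  unfolding layer_above using card_layer_atoms[of U B, folded q] B by (auto simp: layer_def)

lemma card_between_Suc:
  assumes "U \<in> L i" "Z \<in> L (Suc j)" "U \<subseteq> Z" "i \<le> j"
  shows "real (card {W \<in> L j. U \<subseteq> W \<and> W \<subseteq> Z}) = qnum q (Suc j - i)"
proof -
  have "{W \<in> L j. U \<subseteq> W \<and> W \<subseteq> Z} = layer U Z j" using assms by (auto simp: layer_def)
  moreover have "real (card (layer U Z j)) = gauss_binomial q (Suc j - i) (j - i)"
    using card_layer[of U Z j, folded q] assms by (auto simp: layer_def)
  ultimately show ?thesis
    using gauss_binomial_codim_1[OF q_gt_1, of "j - i"] assms(4) by (simp add: Suc_diff_le)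
qed

lemma card_below_Suc: "W \<in> L (Suc k) \<Longrightarrow> a \<le> k \<Longrightarrow> real (card {V \<in> L k. V \<subseteq> W}) = qnum q (Suc k - a)"
  using card_below[of W "Suc k" k] gauss_binomial_codim_1[OF q_gt_1, of "k - a"]
  by (simp add: Suc_diff_le)

lemma card_layer_pos: "a \<le> k \<Longrightarrow> k \<le> b \<Longrightarrow> 0 < real (card (L k))"
  using card_layer[OF A B AB, folded q] gauss_binomial_pos[OF q_gt_1, of "k - a" "b - a"] by simp

lemma card_layer_Suc:
  assumes "a \<le> k"
  shows "real (card (L k)) * qnum q (b - k) = real (card (L (Suc k))) * qnum q (Suc k - a)"
  using sum_card_swap[of "L k" "L (Suc k)" "\<lambda>U W. U \<subseteq> W"] assms
  by (simp add: card_above_Suc card_below_Suc)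

text \<open>Counts from either end the pairs \<open>U \<subseteq> W\<close> of dimensions
  \<open>i\<close> and \<open>j\<close> below one fixed \<open>Z\<close> of dimension
  \<open>Suc j\<close>; \<open>j < b\<close> supplies such a \<open>Z\<close>.\<close>

lemma gauss_binomial_step:
  assumes "a \<le> i" "i \<le> j" "j < b"
  shows "gauss_binomial q (Suc j - a) (i - a) * qnum q (Suc j - i) = gauss_binomial q (j - a) (i - a) * qnum q (Suc j - a)"
proof -
  obtain Z where Z: "Z \<in> L (Suc j)"
    using card_layer_pos[of "Suc j"] assms by fastforce
  let ?X = "{U \<in> L i. U \<subseteq> Z}" and ?Y = "{W \<in> L j. W \<subseteq> Z}"
  have "real (card {W \<in> ?Y. U \<subseteq> W}) = qnum q (Suc j - i)" if "U \<in> ?X" for U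
  proof -
    have "{W \<in> ?Y. U \<subseteq> W} = {W \<in> L j. U \<subseteq> W \<and> W \<subseteq> Z}" by auto
    then show ?thesis using card_between_Suc[of U i Z j] that Z assms by simp
  qed
  moreover have "real (card {U \<in> ?X. U \<subseteq> W}) = gauss_binomial q (j - a) (i - a)" if "W \<in> ?Y" for W
  proof -
    have "{U \<in> ?X. U \<subseteq> W} = {U \<in> L i. U \<subseteq> W}" using that by auto
    then show ?thesis using card_below[of W j i] that assms by simp
  qed
  ultimately show ?thesis
    using sum_card_swap[of ?X ?Y "\<lambda>U W. U \<subseteq> W"] card_below[OF Z, of i] card_below_Suc[OF Z] assms by simp
qed

lemma up_down_difference:
  fixes f :: "('n \<Rightarrow> 'a) set \<Rightarrow> real"
  assumes k: "a \<le> k"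
  shows "(\<Sum>W\<in>L (Suc (Suc k)). (\<Sum>U | U \<in> L (Suc k) \<and> U \<subseteq> W. f U)\<^sup>2) =
    (\<Sum>V\<in>L k. (\<Sum>U | U \<in> L (Suc k) \<and> V \<subseteq> U. f U)\<^sup>2)
      + (qnum q (b - Suc k) - qnum q (Suc k - a)) * (\<Sum>U\<in>L (Suc k). (f U)\<^sup>2)"
proof -
  let ?L = "L (Suc k)"
  let ?up = "\<lambda>U U'. real (card {W \<in> L (Suc (Suc k)). U \<subseteq> W \<and> U' \<subseteq> W})"
  let ?dn = "\<lambda>U U'. real (card {V \<in> L k. V \<subseteq> U \<and> V \<subseteq> U'})"
  let ?d = "qnum q (b - Suc k) - qnum q (Suc k - a)"
  \<comment> \<open>Off the diagonal the two counts agree; on it there are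
    \<open>[b - Suc k]\<close> covers against \<open>[Suc k - a]\<close> cocovers.\<close>
  have c: "?up U U' = ?dn U U' + (if U = U' then ?d else 0)" if "U \<in> ?L" "U' \<in> ?L" for U U'
    using common_cover_iff_common_cocover[of U A B "Suc k" U'] that B k
    by (auto simp: card_above_Suc card_below_Suc)
  have "(\<Sum>U\<in>?L. \<Sum>U'\<in>?L. f U * f U' * ?up U U') =
      (\<Sum>U\<in>?L. \<Sum>U'\<in>?L. f U * f U' * ?dn U U' + (if U = U' then ?d * (f U)\<^sup>2 else 0))"
    by (intro sum.cong refl) (auto simp: c algebra_simps power2_eq_square)
  also have "\<dots> = (\<Sum>U\<in>?L. \<Sum>U'\<in>?L. f U * f U' * ?dn U U') + ?d * (\<Sum>U\<in>?L. (f U)\<^sup>2)"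
    by (simp add: sum.distrib sum_distrib_left)
  finally show ?thesis by (simp add: sum_square_incidence)
qed

lemma sum_below_mean_zero:
  assumes "a \<le> i" "i \<le> j" "j \<le> b" "(\<Sum>U\<in>L i. f U) = (0::real)"
  shows "(\<Sum>W\<in>L j. \<Sum>U | U \<in> L i \<and> U \<subseteq> W. f U) = 0"
proof -
  have "(\<Sum>W\<in>L j. \<Sum>U | U \<in> L i \<and> U \<subseteq> W. f U) = (\<Sum>U\<in>L i. \<Sum>W | W \<in> L j \<and> U \<subseteq> W. f U)"
    by (rule sum.swap_restrict) auto
  also have "\<dots> = (\<Sum>U\<in>L i. gauss_binomial q (b - i) (j - i) * f U)"
    using assms by (intro sum.cong refl) (simp add: card_above)
  finally show ?thesis using assms(4) by (simp flip: sum_distrib_left)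
qed

text \<open>Two distinct subspaces of equal dimension have a common cover iff they have a common cocover,
  so going up and back differs from going down and back only by a multiple of the identity
  (\<open>up_down_difference\<close>); this transports the bound from layer to layer.  The constant
  \<open>[k - a] ([b - k] - 1)\<close> is the exact second eigenvalue, and is what makes the induction close.\<close>

lemma up_operator_bound:
  fixes f :: "('n \<Rightarrow> 'a) set \<Rightarrow> real"
  assumes "a \<le> k" "k < b" "(\<Sum>U\<in>L k. f U) = 0"
  shows "(\<Sum>W\<in>L (Suc k). (\<Sum>U | U \<in> L k \<and> U \<subseteq> W. f U)\<^sup>2)
    \<le> qnum q (k - a) * (qnum q (b - k) - 1) * (\<Sum>U\<in>L k. (f U)\<^sup>2)"
  using assms
proof (induct k arbitrary: f rule: dec_induct)
  \<comment> \<open>Layer \<open>a\<close> consists of \<open>A\<close> alone, so mean zero leaves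
    only the zero function, in accordance with the factor \<open>[a - a]\<close>.\<close>
  case base
  then have "f A = 0" using layer_low[OF A AB] by simp
  then have "(\<Sum>U | U \<in> L a \<and> U \<subseteq> W. f U) = 0" for W
    using layer_low[OF A AB] by (intro sum.neutral) auto
  then show ?case by simp
next
  case (step k)
  let ?L = "L (Suc k)"
  let ?x = "qnum q (Suc k - a)" and ?y = "qnum q (b - Suc k)"
  define h where "h V = (\<Sum>U | U \<in> ?L \<and> V \<subseteq> U. f U)" for V
  define Q where "Q = (\<Sum>V\<in>L k. (h V)\<^sup>2)"
  define N where "N = (\<Sum>U\<in>?L. (f U)\<^sup>2)"
  define K where "K = qnum q (k - a) * (qnum q (b - k) - 1)"
  have K0: "0 \<le> K" unfolding K_def
    using step qnum_nonneg[OF q_gt_1] qnum_ge_1[OF q_gt_1, of "b - k"] by simp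
  have N0: "0 \<le> N" and Q0: "0 \<le> Q" unfolding N_def Q_def by (auto intro: sum_nonneg)
  have "(\<Sum>V\<in>L k. h V) = (\<Sum>U\<in>?L. \<Sum>V | V \<in> L k \<and> V \<subseteq> U. f U)"
    unfolding h_def by (rule sum.swap_restrict) auto
  also have "\<dots> = (\<Sum>U\<in>?L. ?x * f U)"
    using step by (intro sum.cong refl) (simp add: card_below_Suc)
  also have "\<dots> = 0" using step by (simp flip: sum_distrib_left)
  finally have h0: "(\<Sum>V\<in>L k. h V) = 0" .
  \<comment> \<open>\<open>h\<close> is the downward image of \<open>f\<close>, and going up is
    adjoint to going down. So \<open>Q\<close> is also the inner product of \<open>f\<close> with
    the upward image of \<open>h\<close>; Cauchy-Schwarz and the induction hypothesis for
    \<open>h\<close> bound \<open>Q\<^sup>2\<close>, and one factor \<open>Q\<close>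
    cancels.\<close>
  have "Q = (\<Sum>V\<in>L k. \<Sum>U | U \<in> ?L \<and> V \<subseteq> U. f U * h V)"
    unfolding Q_def by (simp add: h_def power2_eq_square sum_distrib_left mult_ac)
  also have "\<dots> = (\<Sum>U\<in>?L. \<Sum>V | V \<in> L k \<and> V \<subseteq> U. f U * h V)"
    by (rule sum.swap_restrict) auto
  also have "\<dots> = (\<Sum>U\<in>?L. f U * (\<Sum>V | V \<in> L k \<and> V \<subseteq> U. h V))"
    by (simp add: sum_distrib_left)
  finally have "Q\<^sup>2 \<le> N * (\<Sum>U\<in>?L. (\<Sum>V | V \<in> L k \<and> V \<subseteq> U. h V)\<^sup>2)"
    using Cauchy_Schwarz_ineq_sum[of f "\<lambda>U. \<Sum>V | V \<in> L k \<and> V \<subseteq> U. h V" ?L] unfolding N_def by simp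
  also have "\<dots> \<le> N * (K * Q)"
    using step.hyps(3)[OF _ h0] step N0 unfolding K_def Q_def by (intro mult_left_mono) auto
  finally have "Q * Q \<le> (K * N) * Q" by (simp add: power2_eq_square mult_ac)
  then have QK: "Q \<le> K * N"
    using Q0 K0 N0 by (cases "Q = 0") auto
  have "(\<Sum>W\<in>L (Suc (Suc k)). (\<Sum>U | U \<in> ?L \<and> U \<subseteq> W. f U)\<^sup>2) = Q + (?y - ?x) * N"
    unfolding Q_def N_def h_def using step by (intro up_down_difference) simp
  also have "\<dots> \<le> (K + ?y - ?x) * N" using QK by (simp add: algebra_simps)
  \<comment> \<open>Since \<open>?x = q * [k - a] + 1\<close> and
    \<open>[b - k] = q * ?y + 1\<close>, the inherited constant \<open>K\<close> is
    \<open>(?x - 1) * ?y\<close>.\<close>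
  also have "K + ?y - ?x = ?x * (?y - 1)"
  proof -
    have "?x = q * qnum q (k - a) + 1" "qnum q (b - k) = q * ?y + 1"
      using qnum_Suc[of q "k - a"] qnum_Suc[of q "b - Suc k"] q_gt_1 step
      by (auto simp: Suc_diff_le Suc_diff_Suc)
    then show ?thesis unfolding K_def by (simp add: algebra_simps)
  qed
  finally show ?case unfolding N_def .
qed

text \<open>Composes \<open>up_operator_bound\<close> one layer at a time, images keeping mean zero
  by \<open>sum_below_mean_zero\<close>. Divided by the layer sizes and by
  \<open>gauss_binomial\<close>, it says that averaging from layer \<open>i\<close> to layer
  \<open>j\<close> contracts the squared norm by \<open>(1 / q) ^ (j - i)\<close>.\<close>

theorem below_operator_bound:
  fixes f :: "('n \<Rightarrow> 'a) set \<Rightarrow> real"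
  assumes "a \<le> i" "i \<le> j" "j \<le> b" and f: "(\<Sum>U\<in>L i. f U) = 0"
  shows "real (card (L i)) * (\<Sum>W\<in>L j. (\<Sum>U | U \<in> L i \<and> U \<subseteq> W. f U)\<^sup>2)
    \<le> (1 / q) ^ (j - i) * real (card (L j)) * (gauss_binomial q (j - a) (i - a))\<^sup>2 * (\<Sum>U\<in>L i. (f U)\<^sup>2)"
  using assms(2,3)
proof (induct j rule: dec_induct)
  case base
  have "(\<Sum>U | U \<in> L i \<and> U \<subseteq> W. f U) = f W" if W: "W \<in> L i" for W
    using layer_below_same[OF W] by simp
  moreover have "gauss_binomial q (i - a) (i - a) = 1"
  proof -
    obtain W where W: "W \<in> L i" using card_layer_pos[of i] assms by fastforce
    show ?thesis using card_below[OF W, of i] layer_below_same[OF W] assms by simp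
  qed
  ultimately show ?case by simp
next
  case (step j)
  define g where "g W = (\<Sum>U | U \<in> L i \<and> U \<subseteq> W. f U)" for W
  define N where "N = (\<Sum>U\<in>L i. (f U)\<^sup>2)"
  let ?c = "gauss_binomial q (j - a) (i - a)" and ?c' = "gauss_binomial q (Suc j - a) (i - a)"
  let ?x = "qnum q (j - a)" and ?x' = "qnum q (Suc j - a)" and ?y = "qnum q (b - j)" and ?z = "qnum q (Suc j - i)"
  let ?n = "\<lambda>k. real (card (L k))"
  have ij: "a \<le> j" "j < b" "j \<le> b" using step assms by auto
  have pos: "0 < ?z" "0 < ?x'" "0 < ?y" "0 \<le> ?x" "1 \<le> ?y"
    using step ij qnum_pos[OF q_gt_1] qnum_nonneg[OF q_gt_1] qnum_ge_1[OF q_gt_1] by auto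
  have N0: "0 \<le> N" unfolding N_def by (auto intro: sum_nonneg)
  \<comment> \<open>Each \<open>U\<close> below \<open>Z\<close> is reached through exactly
    \<open>?z\<close> intermediate \<open>W\<close>, so one upward step from layer \<open>j\<close>
    gives \<open>?z\<close> times the direct sum from layer \<open>i\<close>.\<close>
  have chain: "(\<Sum>W | W \<in> L j \<and> W \<subseteq> Z. g W) = ?z * g Z" if Z: "Z \<in> L (Suc j)" for Z
  proof -
    have "(\<Sum>W | W \<in> L j \<and> W \<subseteq> Z. g W)
        = (\<Sum>W | W \<in> L j \<and> W \<subseteq> Z. \<Sum>U | U \<in> {U \<in> L i. U \<subseteq> Z} \<and> U \<subseteq> W. f U)"
      unfolding g_def by (intro sum.cong refl) auto
    also have "\<dots> = (\<Sum>U | U \<in> L i \<and> U \<subseteq> Z. \<Sum>W | W \<in> {W \<in> L j. W \<subseteq> Z} \<and> U \<subseteq> W. f U)"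
      by (rule sum.swap_restrict) auto
    also have "\<dots> = (\<Sum>U | U \<in> L i \<and> U \<subseteq> Z. ?z * f U)"
    proof (intro sum.cong refl)
      fix U assume "U \<in> {U. U \<in> L i \<and> U \<subseteq> Z}"
      then have "real (card {W \<in> L j. U \<subseteq> W \<and> W \<subseteq> Z}) = ?z"
        using Z step by (intro card_between_Suc) auto
      moreover have "{W. W \<in> {W \<in> L j. W \<subseteq> Z} \<and> U \<subseteq> W} = {W \<in> L j. U \<subseteq> W \<and> W \<subseteq> Z}" by auto
      ultimately show "(\<Sum>W | W \<in> {W \<in> L j. W \<subseteq> Z} \<and> U \<subseteq> W. f U) = ?z * f U" by simp
    qed
    finally show ?thesis by (simp add: g_def sum_distrib_left)
  qed
  have "?z\<^sup>2 * (\<Sum>Z\<in>L (Suc j). (g Z)\<^sup>2) = (\<Sum>Z\<in>L (Suc j). (\<Sum>W | W \<in> L j \<and> W \<subseteq> Z. g W)\<^sup>2)"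
    by (simp add: chain sum_distrib_left power_mult_distrib)
  also have "\<dots> \<le> ?x * (?y - 1) * (\<Sum>W\<in>L j. (g W)\<^sup>2)"
    using sum_below_mean_zero[of i j f] assms step ij unfolding g_def
    by (intro up_operator_bound) auto
  finally have "?n i * (?z\<^sup>2 * (\<Sum>Z\<in>L (Suc j). (g Z)\<^sup>2)) \<le> ?x * (?y - 1) * (?n i * (\<Sum>W\<in>L j. (g W)\<^sup>2))"
    by (simp add: mult_left_mono mult.left_commute)
  also have "\<dots> \<le> ?x * (?y - 1) * ((1 / q) ^ (j - i) * ?n j * ?c\<^sup>2 * N)"
    using step.hyps(3) ij pos unfolding g_def N_def by (intro mult_left_mono) auto
  \<comment> \<open>The factor \<open>1 / q\<close> of this step comes from
    \<open>q * ?x \<le> ?x'\<close>, while \<open>?y - 1\<close> is enlarged to \<open>?y\<close>;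
    the product \<open>?x' * ?y\<close> is the normalisation of one upward step.\<close>
  also have "\<dots> \<le> (1 / q * ?x' * ?y) * ((1 / q) ^ (j - i) * ?n j * ?c\<^sup>2 * N)"
  proof (intro mult_right_mono)
    have "q * ?x \<le> ?x'" using qnum_Suc[of q "j - a"] q_gt_1 ij by (simp add: Suc_diff_le)
    then have "?x \<le> 1 / q * ?x'" using q_gt_1 by (simp add: field_simps)
    then show "?x * (?y - 1) \<le> 1 / q * ?x' * ?y"
      using pos q_gt_1 by (intro mult_mono) auto
  qed (use N0 q_gt_1 in auto)
  also have "\<dots> = (1 / q) ^ (Suc j - i) * (?n j * ?y) * ?x' * ?c\<^sup>2 * N"
    using step by (simp add: Suc_diff_le)
  also have "?n j * ?y = ?n (Suc j) * ?x'" using card_layer_Suc ij by blast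
  also have "(1 / q) ^ (Suc j - i) * (?n (Suc j) * ?x') * ?x' * ?c\<^sup>2 * N
      = (1 / q) ^ (Suc j - i) * ?n (Suc j) * (?c * ?x')\<^sup>2 * N"
    by (simp add: power2_eq_square)
  also have "?c * ?x' = ?c' * ?z" using gauss_binomial_step[of i j] assms step ij by simp
  also have "(1 / q) ^ (Suc j - i) * ?n (Suc j) * (?c' * ?z)\<^sup>2 * N
      = ?z\<^sup>2 * ((1 / q) ^ (Suc j - i) * ?n (Suc j) * ?c'\<^sup>2 * N)"
    by (simp add: power_mult_distrib)
  finally have "?z\<^sup>2 * (?n i * (\<Sum>Z\<in>L (Suc j). (g Z)\<^sup>2)) \<le> ?z\<^sup>2 * ((1 / q) ^ (Suc j - i) * ?n (Suc j) * ?c'\<^sup>2 * N)"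
    by (simp add: mult.left_commute)
  then show ?case using pos(1) unfolding g_def N_def by simp
qed

text \<open>Cauchy-Schwarz with \<open>below_operator_bound\<close>, then the arithmetic-geometric
  mean inequality to turn the product of norms into a sum; this additive form is what allows
  summation along rows of colours. The factor after the power of \<open>1 / sqrt q\<close> is the
  number of incident pairs.\<close>

theorem inclusion_form_bound:
  fixes f g :: "('n \<Rightarrow> 'a) set \<Rightarrow> real"
  assumes ij: "a \<le> i" "i \<le> j" "j \<le> b" and f: "(\<Sum>U\<in>L i. f U) = 0"
  shows "2 * (\<Sum>W\<in>L j. g W * (\<Sum>U | U \<in> L i \<and> U \<subseteq> W. f U))
    \<le> (1 / sqrt q) ^ (j - i) * (real (card (L j)) * gauss_binomial q (j - a) (i - a))
      * ((\<Sum>U\<in>L i. (f U)\<^sup>2) / real (card (L i)) + (\<Sum>W\<in>L j. (g W)\<^sup>2) / real (card (L j)))"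
proof -
  define h where "h W = (\<Sum>U | U \<in> L i \<and> U \<subseteq> W. f U)" for W
  define F where "F = (\<Sum>U\<in>L i. (f U)\<^sup>2)"
  define G where "G = (\<Sum>W\<in>L j. (g W)\<^sup>2)"
  define H where "H = (\<Sum>W\<in>L j. (h W)\<^sup>2)"
  define c where "c = gauss_binomial q (j - a) (i - a)"
  define r where "r = (1 / sqrt q) ^ (j - i)"
  define I where "I = (\<Sum>W\<in>L j. g W * h W)"
  let ?ni = "real (card (L i))" and ?nj = "real (card (L j))"
  have n: "0 < ?ni" "0 < ?nj" using card_layer_pos ij by auto
  have c: "0 < c" unfolding c_def using gauss_binomial_pos[OF q_gt_1] ij by simp
  have r: "0 \<le> r" unfolding r_def using q_gt_1 by simp
  have r2: "r\<^sup>2 = (1 / q) ^ (j - i)"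
  proof -
    have "r\<^sup>2 = ((1 / sqrt q)\<^sup>2) ^ (j - i)"
      unfolding r_def by (simp only: power_mult[symmetric] mult.commute)
    also have "(1 / sqrt q)\<^sup>2 = 1 / q" using q_gt_1 by (simp add: power_divide)
    finally show ?thesis .
  qed
  have FG: "0 \<le> F" "0 \<le> G" unfolding F_def G_def by (auto intro: sum_nonneg)
  have "I\<^sup>2 \<le> G * H" unfolding I_def G_def H_def by (rule Cauchy_Schwarz_ineq_sum)
  moreover have "?ni * H \<le> r\<^sup>2 * ?nj * c\<^sup>2 * F"
    unfolding H_def h_def r2 c_def F_def using below_operator_bound[OF ij f] by simp
  ultimately have "?ni * I\<^sup>2 \<le> G * (r\<^sup>2 * ?nj * c\<^sup>2 * F)"
    using n FG by (smt (verit, best) mult.left_commute mult_left_mono)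
  then have "I\<^sup>2 \<le> (r * ?nj * c)\<^sup>2 * ((F / ?ni) * (G / ?nj))"
  proof -
    assume le: "?ni * I\<^sup>2 \<le> G * (r\<^sup>2 * ?nj * c\<^sup>2 * F)"
    have "I\<^sup>2 \<le> G * (r\<^sup>2 * ?nj * c\<^sup>2 * F) / ?ni"
      using le n(1) by (simp only: pos_le_divide_eq mult.commute)
    also have "G * (r\<^sup>2 * y * c\<^sup>2 * F) / x = (r * y * c)\<^sup>2 * ((F / x) * (G / y))"
      if "0 < x" "0 < y" for x y :: real
      using that by (simp add: field_simps power2_eq_square)
    note this[OF n]
    finally show ?thesis .
  qed
  also have "\<dots> \<le> (r * ?nj * c)\<^sup>2 * ((F / ?ni + G / ?nj) / 2)\<^sup>2"
  proof (intro mult_left_mono)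
    have "x * y \<le> ((x + y) / 2)\<^sup>2" for x y :: real
      using zero_le_power2[of "x - y"] by (simp add: power2_eq_square algebra_simps)
    then show "F / ?ni * (G / ?nj) \<le> ((F / ?ni + G / ?nj) / 2)\<^sup>2" .
  qed auto
  finally have "I\<^sup>2 \<le> (r * ?nj * c * ((F / ?ni + G / ?nj) / 2))\<^sup>2" by (simp only: power_mult_distrib)
  then have "I \<le> r * ?nj * c * ((F / ?ni + G / ?nj) / 2)"
    by (rule power2_le_imp_le) (use r n c FG in auto)
  then show ?thesis unfolding I_def h_def r_def c_def F_def G_def by simp
qed

end

section \<open>Biregular multipartite graphs\<close>

text \<open>\<open>M\<close> is the walk that picks another colour uniformly and then a uniform
  neighbour of that colour. Splitting a function into its colour means and a rest, biregularity
  kills the cross terms, and the symmetric matrix \<open>\<rho>\<close> is bounded by its row sums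
  as in the Schur test.\<close>

lemma partite_second_eig_le:
  fixes X :: "nat \<Rightarrow> 'v set" and R :: real
  assumes C: "finite C" "2 \<le> card C"
    and X: "\<And>i. i \<in> C \<Longrightarrow> finite (X i)" "\<And>i. i \<in> C \<Longrightarrow> X i \<noteq> {}"
    and disj: "\<And>i j. i \<in> C \<Longrightarrow> j \<in> C \<Longrightarrow> i \<noteq> j \<Longrightarrow> X i \<inter> X j = {}"
    and E: "\<And>u v. E u v \<Longrightarrow> E v u"
    and deg: "\<And>i j v. i \<in> C \<Longrightarrow> j \<in> C \<Longrightarrow> i \<noteq> j \<Longrightarrow> v \<in> X i \<Longrightarrow> real (card {u \<in> X j. E v u}) = d i j"
    and deg_pos: "\<And>i j. i \<in> C \<Longrightarrow> j \<in> C \<Longrightarrow> i \<noteq> j \<Longrightarrow> 0 < d i j"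
    and pair: "\<And>i j g. i \<in> C \<Longrightarrow> j \<in> C \<Longrightarrow> i \<noteq> j \<Longrightarrow> sum g (X i) = 0 \<Longrightarrow> sum g (X j) = 0 \<Longrightarrow>
      2 * (\<Sum>v\<in>X i. g v * (\<Sum>u | u \<in> X j \<and> E v u. g u)) \<le> \<rho> i j * (real (card (X i)) * d i j)
        * ((\<Sum>v\<in>X i. (g v)\<^sup>2) / real (card (X i)) + (\<Sum>u\<in>X j. (g u)\<^sup>2) / real (card (X j)))"
    and \<rho>_sym: "\<And>i j. \<rho> i j = \<rho> j i"
    and R: "\<And>i. i \<in> C \<Longrightarrow> (\<Sum>j\<in>C - {i}. \<rho> i j) \<le> R" "0 \<le> R"
    and M: "\<And>i j u v. i \<in> C \<Longrightarrow> j \<in> C \<Longrightarrow> v \<in> X i \<Longrightarrow> u \<in> X j \<Longrightarrow>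
      M v u = (if i \<noteq> j \<and> E v u then 1 / (real (card C - 1) * d i j) else 0)"
  shows "second_eig (\<Union>i\<in>C. X i) M \<le> R / real (card C - 1)"
proof -
  let ?V = "\<Union>i\<in>C. X i" and ?k = "real (card C - 1)"
  define c where "c v = (THE i. i \<in> C \<and> v \<in> X i)" for v
  have c: "c v = i" if "i \<in> C" "v \<in> X i" for i v
    unfolding c_def using that disj by (intro the_equality) blast+
  define n where "n i = real (card (X i))" for i
  \<comment> \<open>Every colour gets total mass one; up to a factor this is the stationary
    distribution of the walk.\<close>
  define w where "w v = 1 / n (c v)" for v
  have n: "0 < n i" if "i \<in> C" for i
    using X that by (simp add: n_def card_gt_0_iff)
  have k: "0 < ?k" using C by simp
  have E_comm: "E u v \<longleftrightarrow> E v u" for u v using E by blast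
  \<comment> \<open>Both sides count the edges between two colours; this is detailed balance of
    \<open>M\<close> with respect to \<open>w\<close>.\<close>
  have handshake: "n i * d i j = n j * d j i" if "i \<in> C" "j \<in> C" "i \<noteq> j" for i j
  proof -
    have "n i * d i j = (\<Sum>v\<in>X i. real (card {u \<in> X j. E v u}))"
      using that by (simp add: deg n_def)
    also have "\<dots> = (\<Sum>u\<in>X j. \<Sum>v | v \<in> X i \<and> E v u. 1)"
      using sum.swap_restrict[of "X i" "X j" "\<lambda>_ _. 1::real" E] X that by simp
    also have "\<dots> = (\<Sum>u\<in>X j. real (card {v \<in> X i. E u v}))"
      by (simp add: E_comm)
    also have "\<dots> = n j * d j i"
      using that by (simp add: deg n_def)
    finally show ?thesis .
  qed
  have sum_V: "(\<Sum>v\<in>?V. h v) = (\<Sum>i\<in>C. \<Sum>v\<in>X i. h v)" for h :: "'v \<Rightarrow> real"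
    using C X disj by (intro sum.UNION_disjoint) auto
  show ?thesis
  proof (rule second_eig_le[where w = w])
    show "finite ?V" using C X by auto
    show "2 \<le> card ?V"
    proof -
      have "card ?V = (\<Sum>i\<in>C. card (X i))"
        using C X disj by (intro card_UN_disjoint) auto
      moreover have "(\<Sum>i\<in>C. 1) \<le> (\<Sum>i\<in>C. card (X i))"
        using X by (intro sum_mono) (simp add: Suc_le_eq card_gt_0_iff)
      ultimately show ?thesis using C by simp
    qed
    show "0 < w v" if "v \<in> ?V" for v
      using that c n by (auto simp: w_def)
    show "w u * M u v = w v * M v u" if uv: "u \<in> ?V" "v \<in> ?V" for u v
    proof -
      obtain i j where ij: "i \<in> C" "u \<in> X i" "j \<in> C" "v \<in> X j" using uv by blast
      have "w u * M u v = (if i \<noteq> j \<and> E u v then 1 / (?k * (n i * d i j)) else 0)"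
        using ij by (simp add: w_def c M)
      also have "\<dots> = (if j \<noteq> i \<and> E v u then 1 / (?k * (n j * d j i)) else 0)"
        using handshake[of i j] E_comm ij by auto
      also have "\<dots> = w v * M v u"
        using ij by (simp add: w_def c M)
      finally show ?thesis .
    qed
    fix f assume f0: "(\<Sum>v\<in>?V. w v * f v) = 0"
    define \<mu> where "\<mu> i = (\<Sum>v\<in>X i. f v) / n i" for i
    define g where "g v = f v - \<mu> (c v)" for v
    define e where "e i j = n i * d i j" for i j
    define N where "N h i = (\<Sum>v\<in>X i. (h v)\<^sup>2) / n i" for h :: "'v \<Rightarrow> real" and i
    have e: "0 < e i j" if "i \<in> C" "j \<in> C" "i \<noteq> j" for i j
      using that n deg_pos by (simp add: e_def)
    have f: "f v = \<mu> i + g v" if "i \<in> C" "v \<in> X i" for i v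
      using that by (simp add: g_def c)
    have g0: "sum g (X i) = 0" if i: "i \<in> C" for i
    proof -
      have "sum g (X i) = (\<Sum>v\<in>X i. f v - \<mu> i)" using i by (intro sum.cong) (auto simp: g_def c)
      also have "\<dots> = (\<Sum>v\<in>X i. f v) - n i * \<mu> i" by (simp add: sum_subtractf n_def)
      finally show ?thesis using n[OF i] by (simp add: \<mu>_def)
    qed
    have \<mu>0: "(\<Sum>i\<in>C. \<mu> i) = 0"
    proof -
      have "(\<Sum>v\<in>?V. w v * f v) = (\<Sum>i\<in>C. \<mu> i)"
        unfolding sum_V by (intro sum.cong) (auto simp: \<mu>_def w_def c sum_divide_distrib)
      then show ?thesis using f0 by simp
    qed
    have N_le: "N g i \<le> N f i" if i: "i \<in> C" for i
    proof -
      have "(\<Sum>v\<in>X i. (f v)\<^sup>2) = (\<Sum>v\<in>X i. (\<mu> i)\<^sup>2 + 2 * \<mu> i * g v + (g v)\<^sup>2)"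
        using i by (intro sum.cong) (auto simp: f power2_eq_square algebra_simps)
      also have "\<dots> = n i * (\<mu> i)\<^sup>2 + (\<Sum>v\<in>X i. (g v)\<^sup>2)"
        using g0[OF i] by (simp add: sum.distrib n_def flip: sum_distrib_left)
      finally have "(\<Sum>v\<in>X i. (g v)\<^sup>2) \<le> (\<Sum>v\<in>X i. (f v)\<^sup>2)"
        using n[OF i] by simp
      then show ?thesis unfolding N_def using n[OF i] by (simp add: divide_right_mono)
    qed
    have form: "(\<Sum>v\<in>X i. f v * (\<Sum>u | u \<in> X j \<and> E v u. f u)) \<le> e i j * (\<mu> i * \<mu> j + \<rho> i j / 2 * (N g i + N g j))"
      if ij: "i \<in> C" "j \<in> C" "i \<noteq> j" for i j
    proof -
      have deg_sum: "(\<Sum>u | u \<in> X j \<and> E v u. f u) = d i j * \<mu> j + (\<Sum>u | u \<in> X j \<and> E v u. g u)"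
        if v: "v \<in> X i" for v
      proof -
        have "(\<Sum>u | u \<in> X j \<and> E v u. f u) = (\<Sum>u | u \<in> X j \<and> E v u. \<mu> j + g u)"
          using ij by (intro sum.cong) (auto simp: f)
        then show ?thesis using deg[OF ij v] by (simp add: sum.distrib)
      qed
      \<comment> \<open>Summed over all \<open>v\<close>, the neighbour sums contain each
        \<open>g u\<close> exactly \<open>d j i\<close> times and vanish with the mean of
        \<open>g\<close>; this removes the cross term with \<open>\<mu> i\<close>.\<close>
      have swap: "(\<Sum>v\<in>X i. \<Sum>u | u \<in> X j \<and> E v u. g u) = 0"
      proof -
        have "(\<Sum>v\<in>X i. \<Sum>u | u \<in> X j \<and> E v u. g u) = (\<Sum>u\<in>X j. \<Sum>v | v \<in> X i \<and> E v u. g u)"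
          using X ij by (intro sum.swap_restrict) auto
        also have "\<dots> = (\<Sum>u\<in>X j. d j i * g u)"
          using deg[of j i] ij by (intro sum.cong refl) (simp add: E_comm)
        finally show ?thesis using g0 ij by (simp flip: sum_distrib_left)
      qed
      have "(\<Sum>v\<in>X i. f v * (\<Sum>u | u \<in> X j \<and> E v u. f u))
          = (\<Sum>v\<in>X i. (\<mu> i + g v) * (d i j * \<mu> j + (\<Sum>u | u \<in> X j \<and> E v u. g u)))"
        using ij by (intro sum.cong refl) (simp only: deg_sum, simp add: f)
      also have "\<dots> = (\<Sum>v\<in>X i. d i j * \<mu> i * \<mu> j + d i j * \<mu> j * g v
          + \<mu> i * (\<Sum>u | u \<in> X j \<and> E v u. g u) + g v * (\<Sum>u | u \<in> X j \<and> E v u. g u))"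
        by (intro sum.cong refl) (simp add: algebra_simps)
      also have "\<dots> = e i j * (\<mu> i * \<mu> j) + (\<Sum>v\<in>X i. g v * (\<Sum>u | u \<in> X j \<and> E v u. g u))"
        using g0 ij swap by (simp add: sum.distrib e_def n_def flip: sum_distrib_left)
      also have "(\<Sum>v\<in>X i. g v * (\<Sum>u | u \<in> X j \<and> E v u. g u)) \<le> e i j * (\<rho> i j / 2 * (N g i + N g j))"
        using pair[OF ij g0[OF ij(1)] g0[OF ij(2)]] unfolding e_def N_def n_def
        by (simp add: mult_ac)
      finally show ?thesis by (simp add: algebra_simps)
    qed
    have "(\<Sum>v\<in>?V. \<Sum>u\<in>?V. w v * f v * M v u * f u)
        = (\<Sum>i\<in>C. \<Sum>v\<in>X i. \<Sum>j\<in>C. \<Sum>u\<in>X j. w v * f v * M v u * f u)"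
      unfolding sum_V ..
    also have "\<dots> = (\<Sum>i\<in>C. \<Sum>j\<in>C. \<Sum>v\<in>X i. \<Sum>u\<in>X j. w v * f v * M v u * f u)"
      by (intro sum.cong refl sum.swap)
    also have "\<dots> = (\<Sum>i\<in>C. \<Sum>j\<in>C - {i}. (\<Sum>v\<in>X i. f v * (\<Sum>u | u \<in> X j \<and> E v u. f u)) / (?k * e i j))"
    proof (rule sum.cong[OF refl])
      fix i assume i: "i \<in> C"
      have "(\<Sum>j\<in>C. \<Sum>v\<in>X i. \<Sum>u\<in>X j. w v * f v * M v u * f u)
          = (\<Sum>v\<in>X i. \<Sum>u\<in>X i. w v * f v * M v u * f u)
            + (\<Sum>j\<in>C - {i}. \<Sum>v\<in>X i. \<Sum>u\<in>X j. w v * f v * M v u * f u)"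
        using C i by (simp add: sum.remove)
      also have "(\<Sum>v\<in>X i. \<Sum>u\<in>X i. w v * f v * M v u * f u) = 0"
        using i by (intro sum.neutral ballI) (simp add: M)
      also have "(\<Sum>j\<in>C - {i}. \<Sum>v\<in>X i. \<Sum>u\<in>X j. w v * f v * M v u * f u)
          = (\<Sum>j\<in>C - {i}. (\<Sum>v\<in>X i. f v * (\<Sum>u | u \<in> X j \<and> E v u. f u)) / (?k * e i j))"
      proof (intro sum.cong refl)
        fix j assume j: "j \<in> C - {i}"
        have "(\<Sum>u\<in>X j. w v * f v * M v u * f u) = f v * (\<Sum>u | u \<in> X j \<and> E v u. f u) / (?k * e i j)"
          if v: "v \<in> X i" for v
        proof -
          have "(\<Sum>u\<in>X j. w v * f v * M v u * f u) = (\<Sum>u\<in>X j. if E v u then f v * f u / (?k * e i j) else 0)"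
            using i j v by (intro sum.cong refl) (auto simp: M w_def c e_def)
          also have "\<dots> = (\<Sum>u | u \<in> X j \<and> E v u. f v * f u / (?k * e i j))"
            using X j by (simp only: sum.inter_filter DiffD1)
          finally show ?thesis by (simp add: sum_distrib_left sum_divide_distrib)
        qed
        then show "(\<Sum>v\<in>X i. \<Sum>u\<in>X j. w v * f v * M v u * f u)
            = (\<Sum>v\<in>X i. f v * (\<Sum>u | u \<in> X j \<and> E v u. f u)) / (?k * e i j)"
          by (simp add: sum_divide_distrib)
      qed
      finally show "(\<Sum>j\<in>C. \<Sum>v\<in>X i. \<Sum>u\<in>X j. w v * f v * M v u * f u)
          = (\<Sum>j\<in>C - {i}. (\<Sum>v\<in>X i. f v * (\<Sum>u | u \<in> X j \<and> E v u. f u)) / (?k * e i j))" by simp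
    qed
    also have "\<dots> \<le> (\<Sum>i\<in>C. \<Sum>j\<in>C - {i}. (\<mu> i * \<mu> j + \<rho> i j / 2 * (N g i + N g j)) / ?k)"
    proof (intro sum_mono)
      fix i j assume ij: "i \<in> C" "j \<in> C - {i}"
      have "(\<Sum>v\<in>X i. f v * (\<Sum>u | u \<in> X j \<and> E v u. f u)) / (?k * e i j)
          \<le> e i j * (\<mu> i * \<mu> j + \<rho> i j / 2 * (N g i + N g j)) / (?k * e i j)"
        using form[of i j] ij e[of i j] k by (intro divide_right_mono) auto
      also have "\<dots> = (\<mu> i * \<mu> j + \<rho> i j / 2 * (N g i + N g j)) / ?k"
        using e[of i j] ij by simp
      finally show "(\<Sum>v\<in>X i. f v * (\<Sum>u | u \<in> X j \<and> E v u. f u)) / (?k * e i j)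
          \<le> (\<mu> i * \<mu> j + \<rho> i j / 2 * (N g i + N g j)) / ?k" .
    qed
    also have "\<dots> = ((\<Sum>i\<in>C. \<Sum>j\<in>C - {i}. \<mu> i * \<mu> j)
        + (\<Sum>i\<in>C. \<Sum>j\<in>C - {i}. \<rho> i j / 2 * (N g i + N g j))) / ?k"
      by (simp add: sum.distrib sum_divide_distrib add_divide_distrib)
    \<comment> \<open>The full double sum is the square of the vanishing total mean, so dropping its
      diagonal leaves minus a sum of squares.\<close>
    also have "(\<Sum>i\<in>C. \<Sum>j\<in>C - {i}. \<mu> i * \<mu> j) \<le> 0"
    proof -
      have "(\<Sum>j\<in>C - {i}. \<mu> i * \<mu> j) = - (\<mu> i)\<^sup>2" if "i \<in> C" for i
      proof -
        have "(\<Sum>j\<in>C - {i}. \<mu> j) = - \<mu> i" using C that \<mu>0 by (simp add: sum_diff1)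
        then show ?thesis by (simp add: power2_eq_square flip: sum_distrib_left)
      qed
      then show ?thesis by (simp add: sum_negf sum_nonneg)
    qed
    also have "(\<Sum>i\<in>C. \<Sum>j\<in>C - {i}. \<rho> i j / 2 * (N g i + N g j)) \<le> R * (\<Sum>i\<in>C. N f i)"
    proof -
      \<comment> \<open>By symmetry of \<open>\<rho>\<close> the two halves of
        \<open>N g i + N g j\<close> contribute equally, so each \<open>N g i\<close> collects a
        whole row sum.\<close>
      have "(\<Sum>i\<in>C. \<Sum>j\<in>C - {i}. \<rho> i j / 2 * N g j) = (\<Sum>j\<in>C. \<Sum>i\<in>C - {j}. \<rho> i j / 2 * N g j)"
      proof -
        have "{j \<in> C. i \<noteq> j} = C - {i}" "{j \<in> C. j \<noteq> i} = C - {i}" for i by auto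
        then show ?thesis
          using sum.swap_restrict[OF C(1) C(1), of "\<lambda>i j. \<rho> i j / 2 * N g j" "\<lambda>i j. i \<noteq> j"] by simp
      qed
      also have "\<dots> = (\<Sum>i\<in>C. \<Sum>j\<in>C - {i}. \<rho> i j / 2 * N g i)"
        using \<rho>_sym by simp
      finally have swap: "(\<Sum>i\<in>C. \<Sum>j\<in>C - {i}. \<rho> i j / 2 * N g j) = (\<Sum>i\<in>C. \<Sum>j\<in>C - {i}. \<rho> i j / 2 * N g i)" .
      have "(\<Sum>i\<in>C. \<Sum>j\<in>C - {i}. \<rho> i j / 2 * (N g i + N g j))
          = (\<Sum>i\<in>C. \<Sum>j\<in>C - {i}. \<rho> i j / 2 * N g i + \<rho> i j / 2 * N g i)"
        by (simp only: distrib_left sum.distrib swap)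
      also have "\<dots> = (\<Sum>i\<in>C. (\<Sum>j\<in>C - {i}. \<rho> i j) * N g i)"
        by (simp add: mult.commute flip: sum_distrib_left)
      also have "\<dots> \<le> (\<Sum>i\<in>C. R * N f i)"
      proof (intro sum_mono)
        fix i assume i: "i \<in> C"
        have "0 \<le> N g i" unfolding N_def using n[OF i] by (simp add: sum_nonneg)
        then have "(\<Sum>j\<in>C - {i}. \<rho> i j) * N g i \<le> R * N g i" using R(1)[OF i] by (intro mult_right_mono)
        also have "\<dots> \<le> R * N f i" using R(2) N_le[OF i] by (intro mult_left_mono)
        finally show "(\<Sum>j\<in>C - {i}. \<rho> i j) * N g i \<le> R * N f i" .
      qed
      finally show ?thesis by (simp add: sum_distrib_left)
    qed
    also have "(\<Sum>i\<in>C. N f i) = (\<Sum>v\<in>?V. w v * (f v)\<^sup>2)"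
      unfolding sum_V by (intro sum.cong) (auto simp: N_def w_def c sum_divide_distrib)
    finally show "(\<Sum>v\<in>?V. \<Sum>u\<in>?V. w v * f v * M v u * f u) \<le> R / ?k * (\<Sum>v\<in>?V. w v * (f v)\<^sup>2)"
      using k by (simp add: divide_right_mono)
  qed
qed

section \<open>Links of chains of subspaces\<close>

definition subspace_chain :: "('n \<Rightarrow> 'a::field) set set \<Rightarrow> bool" where
  "subspace_chain s \<longleftrightarrow> (\<forall>U\<in>s. is_subspace U) \<and> (\<forall>U\<in>s. \<forall>W\<in>s. U \<subseteq> W \<or> W \<subseteq> U)"

definition chain_ext :: "('n \<Rightarrow> 'a::field) set set \<Rightarrow> nat \<Rightarrow> ('n \<Rightarrow> 'a) set set" where
  "chain_ext s i = {U. is_subspace U \<and> sdim U = i \<and> (\<forall>V\<in>s. U \<subseteq> V \<or> V \<subseteq> U)}"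

text \<open>In a chain the union is its largest member. The span turns the empty union into
  \<open>{0}\<close>, just as the empty intersection in \<open>gap_up\<close> is the whole space, so
  both ends of a flag are covered by the same formula.\<close>

definition gap_low :: "('n \<Rightarrow> 'a::field) set set \<Rightarrow> nat \<Rightarrow> ('n \<Rightarrow> 'a) set" where
  "gap_low s i = Modules.module.span vscale (\<Union>{V \<in> s. sdim V < i})"

definition gap_up :: "('n \<Rightarrow> 'a::field) set set \<Rightarrow> nat \<Rightarrow> ('n \<Rightarrow> 'a) set" where
  "gap_up s i = \<Inter>{V \<in> s. i < sdim V}"

text \<open>The Gaussian binomial of the gap of \<open>c\<close> around \<open>i\<close>; the
  inserted \<open>0\<close> and \<open>n\<close> are the dimensions of the zero space and of the
  whole space. It refers to dimensions only, which is the source of all regularity in the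
  links.\<close>

definition ext_count :: "real \<Rightarrow> nat \<Rightarrow> nat set \<Rightarrow> nat \<Rightarrow> real" where
  "ext_count q n c i = (let l = Max (insert 0 {k \<in> c. k < i}); u = Min (insert n {k \<in> c. i < k})
     in gauss_binomial q (u - l) (i - l))"

lemma subset_if_sdim_less:
  fixes U W :: "('n::finite \<Rightarrow> 'a::field) set"
  assumes "U \<subseteq> W \<or> W \<subseteq> U" "sdim U < sdim W"
  shows "U \<subseteq> W"
  using assms sdim_mono[of W U] by auto

lemma chain_eqI:
  fixes U W :: "('n::finite \<Rightarrow> 'a::field) set"
  assumes "subspace_chain s" "U \<in> s" "W \<in> s" "sdim U = sdim W"
  shows "U = W"
  using assms subspace_eqI[of U W] subspace_eqI[of W U] unfolding subspace_chain_def by (metis order_refl)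

lemma chain_inj:
  fixes s :: "('n::finite \<Rightarrow> 'a::field) set set"
  shows "subspace_chain s \<Longrightarrow> inj_on sdim s"
  by (meson chain_eqI inj_onI)

lemma chain_insert: "subspace_chain s \<Longrightarrow> U \<in> chain_ext s i \<Longrightarrow> subspace_chain (insert U s)"
  by (auto simp: subspace_chain_def chain_ext_def)

lemma chain_ext_insert: "chain_ext (insert W s) i = {U \<in> chain_ext s i. W \<subseteq> U \<or> U \<subseteq> W}"
  by (auto simp: chain_ext_def)

lemma sdim_image_insert: "U \<in> chain_ext s i \<Longrightarrow> sdim ` insert U s = insert i (sdim ` s)"
  by (auto simp: chain_ext_def)

text \<open>As \<open>i\<close> is not a dimension of \<open>s\<close>, each member has smaller or
  larger dimension than \<open>i\<close>, and comparability becomes containment in a definite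
  direction.\<close>

lemma chain_ext_eq_layer:
  fixes s :: "('n::finite \<Rightarrow> 'a::field) set set"
  assumes i: "i \<notin> sdim ` s"
  shows "chain_ext s i = layer (gap_low s i) (gap_up s i) i"
proof (intro equalityI subsetI)
  fix U assume "U \<in> chain_ext s i"
  then have U: "is_subspace U" "sdim U = i" and c: "\<And>V. V \<in> s \<Longrightarrow> U \<subseteq> V \<or> V \<subseteq> U"
    by (auto simp: chain_ext_def)
  have "V \<subseteq> U" if "V \<in> s" "sdim V < i" for V
    using that U c[of V] by (intro subset_if_sdim_less) auto
  then have "gap_low s i \<subseteq> U" unfolding gap_low_def
    using U by (intro fvs.span_minimal) (auto simp: is_subspace_iff)
  moreover have "U \<subseteq> V" if "V \<in> s" "i < sdim V" for V
    using that U c[of V] by (intro subset_if_sdim_less) auto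
  then have "U \<subseteq> gap_up s i" unfolding gap_up_def by blast
  ultimately show "U \<in> layer (gap_low s i) (gap_up s i) i"
    using U by (simp add: layer_def)
next
  fix U assume "U \<in> layer (gap_low s i) (gap_up s i) i"
  then have U: "is_subspace U" "sdim U = i" "gap_low s i \<subseteq> U" "U \<subseteq> gap_up s i"
    by (auto simp: layer_def)
  have "U \<subseteq> V \<or> V \<subseteq> U" if V: "V \<in> s" for V
  proof (cases "sdim V < i")
    case True
    then have "V \<subseteq> gap_low s i" unfolding gap_low_def
      using V fvs.span_superset[of "\<Union>{V \<in> s. sdim V < i}"] by blast
    then show ?thesis using U by blast
  next
    case False
    then have "i < sdim V" using V i by (metis imageI linorder_neqE_nat)
    then have "gap_up s i \<subseteq> V" unfolding gap_up_def using V by blast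
    then show ?thesis using U by blast
  qed
  then show "U \<in> chain_ext s i" using U by (simp add: chain_ext_def)
qed

lemma gap_interval:
  fixes s :: "('n::finite \<Rightarrow> 'a::{field,finite}) set set"
  assumes s: "subspace_chain s"
  shows "subspace_interval (gap_low s i) (gap_up s i) (real CARD('a))"
proof
  show "is_subspace (gap_low s i)" by (simp add: gap_low_def is_subspace_iff)
  show up: "is_subspace (gap_up s i)" unfolding gap_up_def is_subspace_iff
    using s by (intro fvs.subspace_Inter) (auto simp: subspace_chain_def is_subspace_iff)
  have "V \<subseteq> W" if "V \<in> s" "sdim V < i" "W \<in> s" "i < sdim W" for V W
    using that s subset_if_sdim_less[of V W] by (auto simp: subspace_chain_def)
  then have "\<Union>{V \<in> s. sdim V < i} \<subseteq> gap_up s i" unfolding gap_up_def by blast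
  then show "gap_low s i \<subseteq> gap_up s i" unfolding gap_low_def
    using up by (intro fvs.span_minimal) (auto simp: is_subspace_iff)
qed simp

lemma sdim_gap_low:
  fixes s :: "('n::finite \<Rightarrow> 'a::{field,finite}) set set"
  assumes s: "subspace_chain s"
  shows "sdim (gap_low s i) = Max (insert 0 {k \<in> sdim ` s. k < i})"
proof -
  let ?P = "{V \<in> s. sdim V < i}"
  have K: "{k \<in> sdim ` s. k < i} = sdim ` ?P" by auto
  show ?thesis
  proof (cases "?P = {}")
    case True
    then have "gap_low s i = {0}" unfolding gap_low_def True by (simp only: Union_empty fvs.span_empty)
    then show ?thesis unfolding K True by (simp add: sdim_eq_dim)
  next
    case False
    then have "Max (sdim ` ?P) \<in> sdim ` ?P" by (intro Max_in) auto
    then obtain V where V: "V \<in> ?P" "sdim V = Max (sdim ` ?P)" by auto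
    have "W \<subseteq> V" if W: "W \<in> ?P" for W
    proof -
      have "sdim W \<le> sdim V" unfolding V(2) using W by (intro Max_ge) auto
      moreover have "W \<subseteq> V \<or> V \<subseteq> W" "is_subspace V" "is_subspace W"
        using s V W by (auto simp: subspace_chain_def)
      ultimately show ?thesis using subspace_eqI[of V W] by blast
    qed
    then have "\<Union>?P = V" using V by blast
    moreover have "is_subspace V" using V s by (simp add: subspace_chain_def)
    ultimately have "gap_low s i = V"
      unfolding gap_low_def by (simp add: is_subspace_iff fvs.span_eq_iff[THEN iffD2])
    then show ?thesis unfolding K using V False by simp
  qed
qed

lemma sdim_gap_up:
  fixes s :: "('n::finite \<Rightarrow> 'a::{field,finite}) set set"
  assumes s: "subspace_chain s"
  shows "sdim (gap_up s i) = Min (insert CARD('n) {k \<in> sdim ` s. i < k})"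
proof -
  let ?P = "{V \<in> s. i < sdim V}"
  have K: "{k \<in> sdim ` s. i < k} = sdim ` ?P" by auto
  show ?thesis
  proof (cases "?P = {}")
    case True
    then have "gap_up s i = UNIV" unfolding gap_up_def by (simp only: Inter_empty)
    then show ?thesis unfolding K True by (simp add: sdim_UNIV)
  next
    case False
    then have "Min (sdim ` ?P) \<in> sdim ` ?P" by (intro Min_in) auto
    then obtain V where V: "V \<in> ?P" "sdim V = Min (sdim ` ?P)" by auto
    have "V \<subseteq> W" if W: "W \<in> ?P" for W
    proof -
      have "sdim V \<le> sdim W" unfolding V(2) using W by (intro Min_le) auto
      moreover have "W \<subseteq> V \<or> V \<subseteq> W" "is_subspace V" "is_subspace W"
        using s V W by (auto simp: subspace_chain_def)
      ultimately show ?thesis using subspace_eqI[of W V] by blast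
    qed
    then have "gap_up s i = V" using V unfolding gap_up_def by blast
    moreover have "sdim V \<le> CARD('n)"
      using sdim_mono[of V UNIV] by (simp add: sdim_UNIV)
    ultimately show ?thesis unfolding K using V False by (simp add: Min_insert)
  qed
qed

lemma gap_bounds:
  fixes s :: "('n::finite \<Rightarrow> 'a::{field,finite}) set set"
  assumes "subspace_chain s" "i \<le> CARD('n)"
  shows "sdim (gap_low s i) \<le> i" "i \<le> sdim (gap_up s i)"
  using assms by (auto simp: sdim_gap_low sdim_gap_up)

lemma card_chain_ext:
  fixes s :: "('n::finite \<Rightarrow> 'a::{field,finite}) set set"
  assumes s: "subspace_chain s" and i: "i \<notin> sdim ` s" "i \<le> CARD('n)"
  shows "real (card (chain_ext s i)) = ext_count (real CARD('a)) CARD('n) (sdim ` s) i"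
    and "0 < card (chain_ext s i)"
proof -
  interpret subspace_interval "gap_low s i" "gap_up s i" "real CARD('a)"
    by (rule gap_interval[OF s])
  show "real (card (chain_ext s i)) = ext_count (real CARD('a)) CARD('n) (sdim ` s) i"
    unfolding chain_ext_eq_layer[OF i(1)] ext_count_def Let_def
    using card_layer[OF A B AB gap_bounds[OF s i(2)]] sdim_gap_low[OF s] sdim_gap_up[OF s] by simp
  show "0 < card (chain_ext s i)"
    unfolding chain_ext_eq_layer[OF i(1)]
    using card_layer_pos[OF gap_bounds[OF s i(2)]] by simp
qed

text \<open>Extensions of \<open>s\<close> comparable with \<open>W\<close> are the extensions of
  the longer chain \<open>insert W s\<close>, so degrees are again values of
  \<open>ext_count\<close>.\<close>

lemma card_chain_ext_comparable:
  fixes s :: "('n::finite \<Rightarrow> 'a::{field,finite}) set set"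
  assumes s: "subspace_chain s" and i: "i \<notin> sdim ` s" "i \<le> CARD('n)" and j: "j \<notin> sdim ` s" "j \<le> CARD('n)"
    and ij: "i \<noteq> j" and W: "W \<in> chain_ext s j"
  shows "real (card {U \<in> chain_ext s i. W \<subseteq> U \<or> U \<subseteq> W}) = ext_count (real CARD('a)) CARD('n) (insert j (sdim ` s)) i"
    and "0 < card {U \<in> chain_ext s i. W \<subseteq> U \<or> U \<subseteq> W}"
  using card_chain_ext[OF chain_insert[OF s W], of i] i ij
  unfolding sdim_image_insert[OF W] chain_ext_insert by auto

lemma comparable_iff_subset:
  fixes s :: "('n::finite \<Rightarrow> 'a::field) set set"
  assumes "U \<in> chain_ext s i" "W \<in> chain_ext s j" "i < j"
  shows "W \<subseteq> U \<or> U \<subseteq> W \<longleftrightarrow> U \<subseteq> W"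
  using assms subset_if_sdim_less[of U W] by (auto simp: chain_ext_def)

lemma inclusion_pair_bound:
  fixes s :: "('n::finite \<Rightarrow> 'a::{field,finite}) set set" and g :: "('n \<Rightarrow> 'a) set \<Rightarrow> real"
  assumes s: "subspace_chain s" and i: "i \<notin> sdim ` s" "i \<le> CARD('n)" and j: "j \<notin> sdim ` s" "j \<le> CARD('n)"
    and ij: "i < j" and g: "sum g (chain_ext s i) = 0"
  shows "2 * (\<Sum>W\<in>chain_ext s j. g W * (\<Sum>U | U \<in> chain_ext s i \<and> U \<subseteq> W. g U))
    \<le> (1 / sqrt (real CARD('a))) ^ (j - i)
      * (real (card (chain_ext s j)) * ext_count (real CARD('a)) CARD('n) (insert j (sdim ` s)) i)
      * ((\<Sum>U\<in>chain_ext s i. (g U)\<^sup>2) / real (card (chain_ext s i))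
        + (\<Sum>W\<in>chain_ext s j. (g W)\<^sup>2) / real (card (chain_ext s j)))"
proof -
  obtain W where W: "W \<in> chain_ext s j"
    using card_chain_ext(2)[OF s j] by fastforce
  have cnt: "real (card {U \<in> chain_ext s i. W \<subseteq> U \<or> U \<subseteq> W}) = ext_count (real CARD('a)) CARD('n) (insert j (sdim ` s)) i"
    using card_chain_ext_comparable(1)[OF s i j _ W] ij by simp
  have sub: "{U \<in> chain_ext s i. W \<subseteq> U \<or> U \<subseteq> W} = {U \<in> chain_ext s i. U \<subseteq> W}"
    using comparable_iff_subset[OF _ W ij] by blast
  show ?thesis
  proof (cases "\<exists>V\<in>s. i < sdim V \<and> sdim V < j")
    case True \<comment> \<open>the bipartite graph between the two colours is complete\<close>
    then obtain V where V: "V \<in> s" "i < sdim V" "sdim V < j" by blast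
    have "U \<subseteq> V" if "U \<in> chain_ext s i" for U
      using that V subset_if_sdim_less[of U V] by (auto simp: chain_ext_def)
    moreover have "V \<subseteq> W" if "W \<in> chain_ext s j" for W
      using that V subset_if_sdim_less[of V W] by (auto simp: chain_ext_def)
    ultimately have "{U. U \<in> chain_ext s i \<and> U \<subseteq> W} = chain_ext s i" if "W \<in> chain_ext s j" for W
      using that by blast
    then have "(\<Sum>W\<in>chain_ext s j. g W * (\<Sum>U | U \<in> chain_ext s i \<and> U \<subseteq> W. g U)) = 0"
      using g by simp
    moreover have "0 \<le> ext_count (real CARD('a)) CARD('n) (insert j (sdim ` s)) i"
      unfolding cnt[symmetric] by simp
    ultimately show ?thesis by (simp add: sum_nonneg)
  next
    case False
    have ne: "sdim V \<noteq> i" "sdim V \<noteq> j" if "V \<in> s" for V using that i j by auto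
    \<comment> \<open>No member of \<open>s\<close> lies between the two dimensions, so
      \<open>i\<close> and \<open>j\<close> see the same gap.\<close>
    have "sdim V < j \<longleftrightarrow> sdim V < i" "j < sdim V \<longleftrightarrow> i < sdim V" if V: "V \<in> s" for V
    proof -
      have "sdim V \<le> i \<or> j \<le> sdim V" using False V by fastforce
      then show "sdim V < j \<longleftrightarrow> sdim V < i" "j < sdim V \<longleftrightarrow> i < sdim V" using ne[OF V] ij by auto
    qed
    then have "{V \<in> s. sdim V < j} = {V \<in> s. sdim V < i}" "{V \<in> s. j < sdim V} = {V \<in> s. i < sdim V}"
      by auto
    then have same: "gap_low s j = gap_low s i" "gap_up s j = gap_up s i"
      by (simp_all add: gap_low_def gap_up_def)
    interpret subspace_interval "gap_low s i" "gap_up s i" "real CARD('a)"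
      by (rule gap_interval[OF s])
    have Li: "chain_ext s i = layer (gap_low s i) (gap_up s i) i"
      by (rule chain_ext_eq_layer[OF i(1)])
    have Lj: "chain_ext s j = layer (gap_low s i) (gap_up s i) j"
      using chain_ext_eq_layer[OF j(1)] same by simp
    have bounds: "sdim (gap_low s i) \<le> i" "j \<le> sdim (gap_up s i)"
      using gap_bounds[OF s i(2)] gap_bounds[OF s j(2)] same by auto
    \<comment> \<open>Both sides count the subspaces of dimension \<open>i\<close> in the interval
      below one \<open>W\<close>, which spares evaluating \<open>Max\<close> and
      \<open>Min\<close>.\<close>
    have "ext_count (real CARD('a)) CARD('n) (insert j (sdim ` s)) i
        = gauss_binomial (real CARD('a)) (j - sdim (gap_low s i)) (i - sdim (gap_low s i))"
      using cnt[unfolded sub] card_below[of W j i] W bounds ij unfolding Li Lj by simp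
    then show ?thesis
      unfolding Li Lj using inclusion_form_bound[of i j g g] bounds ij g[unfolded Li] by simp
  qed
qed

text \<open>Under truncated subtraction the exponent is the absolute difference of \<open>i\<close>
  and \<open>j\<close>. For \<open>i < j\<close> the form is transposed, and double counting
  comparable pairs carries the normalising factor to the other side.\<close>

lemma comparable_pair_bound:
  fixes s :: "('n::finite \<Rightarrow> 'a::{field,finite}) set set" and g :: "('n \<Rightarrow> 'a) set \<Rightarrow> real"
  assumes s: "subspace_chain s" and i: "i \<notin> sdim ` s" "i \<le> CARD('n)" and j: "j \<notin> sdim ` s" "j \<le> CARD('n)"
    and ij: "i \<noteq> j" and g: "sum g (chain_ext s i) = 0" "sum g (chain_ext s j) = 0"
  shows "2 * (\<Sum>V\<in>chain_ext s i. g V * (\<Sum>U | U \<in> chain_ext s j \<and> (V \<subseteq> U \<or> U \<subseteq> V). g U))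
    \<le> (1 / sqrt (real CARD('a))) ^ ((i - j) + (j - i))
      * (real (card (chain_ext s i)) * ext_count (real CARD('a)) CARD('n) (insert i (sdim ` s)) j)
      * ((\<Sum>U\<in>chain_ext s i. (g U)\<^sup>2) / real (card (chain_ext s i))
        + (\<Sum>W\<in>chain_ext s j. (g W)\<^sup>2) / real (card (chain_ext s j)))"
proof (cases "j < i")
  case True
  have "(\<Sum>V\<in>chain_ext s i. g V * (\<Sum>U | U \<in> chain_ext s j \<and> (V \<subseteq> U \<or> U \<subseteq> V). g U))
      = (\<Sum>V\<in>chain_ext s i. g V * (\<Sum>U | U \<in> chain_ext s j \<and> U \<subseteq> V. g U))"
    using comparable_iff_subset[OF _ _ True]
    by (intro sum.cong refl arg_cong2[of _ _ _ _ "(*)"]) blast+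
  then show ?thesis
    using inclusion_pair_bound[OF s j i True g(2)] True by (simp add: add.commute)
next
  case False
  then have lt: "i < j" using ij by simp
  have "(\<Sum>V\<in>chain_ext s i. g V * (\<Sum>U | U \<in> chain_ext s j \<and> (V \<subseteq> U \<or> U \<subseteq> V). g U))
      = (\<Sum>V\<in>chain_ext s i. \<Sum>U | U \<in> chain_ext s j \<and> V \<subseteq> U. g V * g U)"
    using comparable_iff_subset[OF _ _ lt] unfolding sum_distrib_left
    by (intro sum.cong refl) blast+
  also have "\<dots> = (\<Sum>U\<in>chain_ext s j. \<Sum>V | V \<in> chain_ext s i \<and> V \<subseteq> U. g V * g U)"
    by (rule sum.swap_restrict) auto
  also have "\<dots> = (\<Sum>U\<in>chain_ext s j. g U * (\<Sum>V | V \<in> chain_ext s i \<and> V \<subseteq> U. g V))"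
    by (simp add: sum_distrib_left mult.commute)
  finally have form: "(\<Sum>V\<in>chain_ext s i. g V * (\<Sum>U | U \<in> chain_ext s j \<and> (V \<subseteq> U \<or> U \<subseteq> V). g U)) = \<dots>" .
  have "(\<Sum>V\<in>chain_ext s i. real (card {U \<in> chain_ext s j. V \<subseteq> U \<or> U \<subseteq> V}))
      = (\<Sum>U\<in>chain_ext s j. real (card {V \<in> chain_ext s i. V \<subseteq> U \<or> U \<subseteq> V}))"
    by (rule sum_card_swap) auto
  then have "real (card (chain_ext s i)) * ext_count (real CARD('a)) CARD('n) (insert i (sdim ` s)) j
      = real (card (chain_ext s j)) * ext_count (real CARD('a)) CARD('n) (insert j (sdim ` s)) i"
    using card_chain_ext_comparable(1)[OF s i j ij] card_chain_ext_comparable(1)[OF s j i]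
      ij by (simp add: disj_commute)
  then show ?thesis
    using inclusion_pair_bound[OF s i j lt g(1)] lt unfolding form by simp
qed

section \<open>Geometric row sums\<close>

lemma sum_powers_le:
  fixes r :: real
  assumes r: "0 \<le> r" "r < 1" and K: "finite K" "0 \<notin> K"
  shows "(\<Sum>k\<in>K. r ^ k) \<le> r / (1 - r)"
proof -
  define m where "m = Max (insert 0 K)"
  have "(\<Sum>k\<in>K. r ^ k) \<le> (\<Sum>k\<in>{1..m}. r ^ k)"
  proof (rule sum_mono2)
    show "K \<subseteq> {1..m}"
    proof
      fix k assume k: "k \<in> K"
      then have "k \<le> m" unfolding m_def using K by (intro Max_ge) auto
      moreover have "k \<noteq> 0" using k K by metis
      ultimately show "k \<in> {1..m}" by simp
    qed
  qed (use r in auto)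
  also have "(1 - r) * (\<Sum>k\<in>{1..m}. r ^ k) = r - r ^ Suc m"
  proof (induct m)
    case (Suc m)
    have step: "(1 - r) * (\<Sum>k\<in>{1..Suc m}. r ^ k) = (1 - r) * (\<Sum>k\<in>{1..m}. r ^ k) + (1 - r) * r ^ Suc m"
      by (simp add: distrib_left)
    show ?case unfolding step Suc by (simp add: algebra_simps)
  qed simp
  then have "(\<Sum>k\<in>{1..m}. r ^ k) = (r - r ^ Suc m) / (1 - r)"
    using r by (simp add: eq_divide_eq mult.commute)
  also have "\<dots> \<le> r / (1 - r)" using r by (intro divide_right_mono) auto
  finally show ?thesis .
qed

text \<open>On each side of \<open>i\<close> the distances are distinct positive numbers, so each
  half is at most a full geometric series, whatever dimensions are missing from
  \<open>C\<close>.\<close>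

lemma sum_distance_powers_le:
  fixes r :: real
  assumes r: "0 \<le> r" "r < 1" and C: "finite C"
  shows "(\<Sum>j\<in>C - {i}. r ^ ((i - j) + (j - i))) \<le> 2 * (r / (1 - r))"
proof -
  let ?lo = "{j \<in> C. j < i}" and ?hi = "{j \<in> C. i < j}"
  have split: "C - {i} = ?lo \<union> ?hi" by auto
  have "(\<Sum>j\<in>C - {i}. r ^ ((i - j) + (j - i)))
      = (\<Sum>j\<in>?lo. r ^ ((i - j) + (j - i))) + (\<Sum>j\<in>?hi. r ^ ((i - j) + (j - i)))"
    unfolding split by (rule sum.union_disjoint) (use C in auto)
  also have "(\<Sum>j\<in>?lo. r ^ ((i - j) + (j - i))) = (\<Sum>k\<in>(\<lambda>j. i - j) ` ?lo. r ^ k)"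
    by (subst sum.reindex) (auto intro!: inj_onI)
  also have "\<dots> \<le> r / (1 - r)" using r C by (intro sum_powers_le) auto
  also have "(\<Sum>j\<in>?hi. r ^ ((i - j) + (j - i))) = (\<Sum>k\<in>(\<lambda>j. j - i) ` ?hi. r ^ k)"
    by (subst sum.reindex) (auto intro!: inj_onI)
  also have "\<dots> \<le> r / (1 - r)" using r C by (intro sum_powers_le) auto
  finally show ?thesis by simp
qed

section \<open>Counting top faces over a chain\<close>

lemma pf_top_chain:
  fixes S :: "nat set"
  assumes "T \<in> (pf_top S :: ('n::finite \<Rightarrow> 'a::{field,finite}) set set set)"
  shows "subspace_chain T" "sdim ` T = S" "inj_on sdim T"
  using assms by (auto simp: pf_top_def pf_vertices_def subspace_chain_def bij_betw_def)

lemma chain_in_pf_top: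
  fixes s :: "('n::finite \<Rightarrow> 'a::{field,finite}) set set"
  assumes "subspace_chain s"
  shows "s \<in> pf_top (sdim ` s)"
  using assms chain_inj[OF assms]
  by (auto simp: pf_top_def pf_vertices_def subspace_chain_def bij_betw_def)

abbreviation tops_over :: "nat set \<Rightarrow> ('n::finite \<Rightarrow> 'a::{field,finite}) set set \<Rightarrow> ('n \<Rightarrow> 'a) set set set" where
  "tops_over S s \<equiv> link_tops (pf_top S) s"

lemma in_tops_over_iff: "T \<in> tops_over S s \<longleftrightarrow> T \<in> pf_top S \<and> s \<subseteq> T"
  by (simp add: link_tops_def)

lemma member_chain_ext: "subspace_chain T \<Longrightarrow> s \<subseteq> T \<Longrightarrow> U \<in> T \<Longrightarrow> U \<in> chain_ext s (sdim U)"
  unfolding subspace_chain_def chain_ext_def by blast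

text \<open>Every top face has exactly one member of the required dimension
  \<open>i\<close>.\<close>

lemma tops_over_partition:
  fixes s :: "('n::finite \<Rightarrow> 'a::{field,finite}) set set"
  assumes i: "i \<in> S"
  shows "card (tops_over S s) = (\<Sum>U\<in>chain_ext s i. card (tops_over S (insert U s)))"
proof -
  have "tops_over S s = (\<Union>U\<in>chain_ext s i. tops_over S (insert U s))"
  proof (intro equalityI subsetI)
    fix T assume T: "T \<in> tops_over S s"
    then have "T \<in> pf_top S" "s \<subseteq> T" by (auto simp: in_tops_over_iff)
    then have "subspace_chain T" "sdim ` T = S" "s \<subseteq> T"
      using pf_top_chain[of T S] by blast+
    moreover obtain U where "U \<in> T" "sdim U = i" using i calculation by blast
    ultimately have "U \<in> chain_ext s i" "T \<in> tops_over S (insert U s)"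
      using T member_chain_ext[of T s U] by (auto simp: in_tops_over_iff)
    then show "T \<in> (\<Union>U\<in>chain_ext s i. tops_over S (insert U s))" by blast
  qed (auto simp: in_tops_over_iff)
  moreover have "tops_over S (insert U s) \<inter> tops_over S (insert V s) = {}"
    if "U \<in> chain_ext s i" "V \<in> chain_ext s i" "U \<noteq> V" for U V
  proof -
    have False if "T \<in> pf_top S" "U \<in> T" "V \<in> T" for T
      using pf_top_chain(3)[OF that(1)] that \<open>U \<in> chain_ext s i\<close> \<open>V \<in> chain_ext s i\<close> \<open>U \<noteq> V\<close>
      by (auto simp: chain_ext_def dest: inj_onD)
    then show ?thesis by (auto simp: in_tops_over_iff)
  qed
  ultimately show ?thesis by (simp add: card_UN_disjoint)
qed

text \<open>Filling in a missing dimension multiplies the count by an \<open>ext_count\<close>,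
  which sees only the set of dimensions; the induction is on the number of missing
  dimensions.\<close>

lemma card_tops_over_by_type:
  assumes S: "finite S" "S \<subseteq> {..CARD('n::finite)}" and c: "c \<subseteq> S"
  shows "\<exists>N>0. \<forall>s :: ('n \<Rightarrow> 'a::{field,finite}) set set.
    subspace_chain s \<and> sdim ` s = c \<longrightarrow> real (card (tops_over S s)) = N"
  using c
proof (induct "card (S - c)" arbitrary: c)
  case 0
  then have c: "c = S" using S by auto
  have "tops_over S s = {s}" if s: "subspace_chain s" "sdim ` s = c" for s :: "('n \<Rightarrow> 'a) set set"
  proof -
    have "T = s" if "T \<in> tops_over S s" for T
    proof -
      have T: "T \<in> pf_top S" "s \<subseteq> T" using that by (auto simp: in_tops_over_iff)
      then have "sdim ` T = sdim ` s" using pf_top_chain(2) s c by blast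
      then show ?thesis using pf_top_chain(3)[OF T(1)] T(2) by (metis inj_on_image_eq_iff order_refl)
    qed
    moreover have "s \<in> tops_over S s"
      using chain_in_pf_top[OF s(1)] s c by (simp add: in_tops_over_iff)
    ultimately show ?thesis by blast
  qed
  then show ?case by (intro exI[of _ 1]) auto
next
  case (Suc m)
  then obtain i where i: "i \<in> S" "i \<notin> c"
    by (metis Diff_iff card.empty ex_in_conv nat.distinct(1))
  have "S - c = insert i (S - insert i c)" using i by auto
  then have "card (S - c) = Suc (card (S - insert i c))"
    using S by (metis Diff_iff card_insert_disjoint finite_Diff insertI1)
  then have "m = card (S - insert i c)" using Suc by simp
  then obtain N where N: "N > 0" "\<And>s :: ('n \<Rightarrow> 'a) set set.
      subspace_chain s \<Longrightarrow> sdim ` s = insert i c \<Longrightarrow> real (card (tops_over S s)) = N"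
    using Suc(1)[of "insert i c"] Suc.prems i by auto
  have iN: "i \<le> CARD('n)" using S i by auto
  define E where "E = ext_count (real CARD('a)) CARD('n) c i"
  have cnt: "real (card (tops_over S s)) = E * N \<and> E > 0" if s: "subspace_chain s" "sdim ` s = c"
    for s :: "('n \<Rightarrow> 'a) set set"
  proof -
    have "real (card (tops_over S s)) = (\<Sum>U\<in>chain_ext s i. N)"
      unfolding tops_over_partition[OF i(1), of s] of_nat_sum
      using N(2)[OF chain_insert[OF s(1)]] s(2) by (intro sum.cong refl) (auto simp: chain_ext_def)
    then show ?thesis
      using card_chain_ext[OF s(1), of i] s i iN by (simp add: E_def)
  qed
  show ?case
  proof (cases "E > 0")
    case True then show ?thesis using cnt N(1) by (intro exI[of _ "E * N"]) auto
  next
    \<comment> \<open>The claim is vacuous here: by \<open>cnt\<close> any chain of type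
      \<open>c\<close> would make \<open>E\<close> positive.\<close>
    case False then show ?thesis using cnt by (intro exI[of _ 1]) auto
  qed
qed

text \<open>All extensions by dimension \<open>i\<close> lie in equally many top faces, so the
  member of dimension \<open>i\<close> in a random top face over \<open>s\<close> is uniformly
  distributed.\<close>

lemma card_tops_over_insert:
  fixes s :: "('n::finite \<Rightarrow> 'a::{field,finite}) set set"
  assumes S: "finite S" "S \<subseteq> {..CARD('n)}" and s: "subspace_chain s" "sdim ` s \<subseteq> S"
    and i: "i \<in> S" "i \<notin> sdim ` s" and U: "U \<in> chain_ext s i"
  shows "real (card (tops_over S s)) = ext_count (real CARD('a)) CARD('n) (sdim ` s) i * real (card (tops_over S (insert U s)))"
    and "0 < card (tops_over S (insert U s))"
proof -
  have "insert i (sdim ` s) \<subseteq> S" using s i by auto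
  from card_tops_over_by_type[OF S this, where 'a = 'a]
  obtain N where N: "N > 0" "\<And>s' :: ('n \<Rightarrow> 'a) set set.
      subspace_chain s' \<Longrightarrow> sdim ` s' = insert i (sdim ` s) \<Longrightarrow> real (card (tops_over S s')) = N"
    by metis
  have *: "real (card (tops_over S (insert V s))) = N" if "V \<in> chain_ext s i" for V
    using N(2)[OF chain_insert[OF s(1) that]] sdim_image_insert[OF that] by simp
  then show "0 < card (tops_over S (insert U s))" using N(1) U by fastforce
  have "i \<le> CARD('n)" using S i by auto
  then show "real (card (tops_over S s)) = ext_count (real CARD('a)) CARD('n) (sdim ` s) i * real (card (tops_over S (insert U s)))"
    unfolding tops_over_partition[OF i(1), of s] of_nat_sum
    using card_chain_ext(1)[OF s(1) i(2)] by (simp add: * U)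
qed

section \<open>The link of a fixed face\<close>

locale flag_link =
  fixes S :: "nat set" and s :: "('n::finite \<Rightarrow> 'a::{field,finite}) set set"
  assumes S: "S \<subseteq> {1..<CARD('n)}" and s: "s \<in> faces_of (pf_top S)"
begin

abbreviation (input) "Top \<equiv> pf_top S :: ('n \<Rightarrow> 'a) set set set"
abbreviation (input) "used \<equiv> sdim ` s"
abbreviation (input) "unused \<equiv> S - used"
abbreviation (input) "d i j \<equiv> ext_count (real CARD('a)) CARD('n) (insert i used) j"
abbreviation (input) "nested U V \<equiv> U \<subseteq> V \<or> V \<subseteq> U"

lemma S_fin: "finite S" and S_le: "S \<subseteq> {..CARD('n)}"
  using S finite_subset by auto

lemma s_chain: "subspace_chain s" and s_cols: "used \<subseteq> S"
proof -
  obtain T where T: "T \<in> Top" "s \<subseteq> T" using s by (auto simp: faces_of_def)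
  show "used \<subseteq> S" using pf_top_chain(2)[OF T(1)] T(2) by blast
  show "subspace_chain s" using pf_top_chain(1)[OF T(1)] T(2) unfolding subspace_chain_def by blast
qed

lemma card_free: "card unused = card S - card s"
  using card_image[OF chain_inj[OF s_chain]] s_cols S_fin by (simp add: card_Diff_subset)

lemma free_le: "i \<in> unused \<Longrightarrow> i \<le> CARD('n)"
  using S_le by auto

lemma card_top_minus: "T \<in> link_tops Top s \<Longrightarrow> card (T - s) = card unused"
  using card_image[OF pf_top_chain(3)[of T S]] pf_top_chain(2)[of T S]
  by (simp add: in_tops_over_iff card_Diff_subset card_free)

lemma ext_notin: "i \<in> unused \<Longrightarrow> U \<in> chain_ext s i \<Longrightarrow> U \<notin> s"
  by (auto simp: chain_ext_def)

lemma tops_pos: "0 < card (tops_over S s)"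
proof -
  obtain T where "T \<in> Top" "s \<subseteq> T" using s by (auto simp: faces_of_def)
  then have "T \<in> tops_over S s" by (simp add: in_tops_over_iff)
  then show ?thesis by (auto simp: card_gt_0_iff)
qed

lemma tops_vertex:
  assumes "i \<in> unused" "U \<in> chain_ext s i"
  shows "0 < card (tops_over S (insert U s))"
  using card_tops_over_insert(2)[OF S_fin S_le s_chain s_cols, of i U] assms by auto

lemma tops_edge:
  assumes i: "i \<in> unused" and j: "j \<in> unused" and ij: "i \<noteq> j"
    and U: "U \<in> chain_ext s i" and V: "V \<in> chain_ext s j" and nest: "nested U V"
  shows "real (card (tops_over S (insert U s))) = d i j * real (card (tops_over S (insert V (insert U s))))"
    and "0 < card (tops_over S (insert V (insert U s)))"
proof -
  have c: "sdim ` insert U s = insert i used" by (rule sdim_image_insert[OF U])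
  have "V \<in> chain_ext (insert U s) j" using V nest by (auto simp: chain_ext_def)
  moreover have "sdim ` insert U s \<subseteq> S" using c s_cols i by simp
  moreover have "j \<notin> sdim ` insert U s" using c j ij by auto
  ultimately show "real (card (tops_over S (insert U s))) = d i j * real (card (tops_over S (insert V (insert U s))))"
    and "0 < card (tops_over S (insert V (insert U s)))"
    using card_tops_over_insert[OF S_fin S_le chain_insert[OF s_chain U], of j V] j unfolding c by auto
qed

lemma link_vertices_eq: "link_vertices Top s = (\<Union>i\<in>unused. chain_ext s i)"
proof (intro equalityI subsetI)
  fix U assume "U \<in> link_vertices Top s"
  then obtain T where T: "T \<in> Top" "s \<subseteq> T" "U \<in> T" "U \<notin> s"
    by (auto simp: link_vertices_def in_tops_over_iff)
  have "sdim U \<notin> used"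
    using pf_top_chain(3)[OF T(1)] T by (auto dest!: inj_onD)
  moreover have "sdim U \<in> S" using pf_top_chain(2)[OF T(1)] T by blast
  moreover have "U \<in> chain_ext s (sdim U)" using member_chain_ext pf_top_chain(1) T by blast
  ultimately show "U \<in> (\<Union>i\<in>unused. chain_ext s i)" by blast
next
  fix U assume "U \<in> (\<Union>i\<in>unused. chain_ext s i)"
  then obtain i where i: "i \<in> unused" "U \<in> chain_ext s i" by blast
  obtain T where "T \<in> tops_over S (insert U s)"
    using tops_vertex[OF i] by (metis card.empty ex_in_conv less_nat_zero_code)
  then show "U \<in> link_vertices Top s"
    using ext_notin[OF i] by (auto simp: link_vertices_def in_tops_over_iff)
qed

lemma pi0_eq:
  assumes "i \<in> unused" "U \<in> chain_ext s i"
  shows "link_pi0 Top s U = card (tops_over S (insert U s)) / card unused / card (tops_over S s)"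
proof -
  have "{T \<in> link_tops Top s. U \<in> T - s} = tops_over S (insert U s)"
    using ext_notin[OF assms] by (auto simp: in_tops_over_iff)
  moreover have "(\<Sum>T\<in>tops_over S (insert U s). 1 / real (card (T - s))) = (\<Sum>T\<in>tops_over S (insert U s). 1 / card unused)"
    by (intro sum.cong refl) (simp add: card_top_minus in_tops_over_iff)
  ultimately show ?thesis unfolding link_pi0_def by simp
qed

lemma pi1_eq:
  assumes "i \<in> unused" "U \<in> chain_ext s i" "j \<in> unused" "V \<in> chain_ext s j"
  shows "link_pi1 Top s U V = card (tops_over S (insert V (insert U s))) / (card unused choose 2) / card (tops_over S s)"
proof -
  have "{T \<in> link_tops Top s. {U, V} \<subseteq> T - s} = tops_over S (insert V (insert U s))"
    using ext_notin[OF assms(1,2)] ext_notin[OF assms(3,4)] by (auto simp: in_tops_over_iff)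
  moreover have "(\<Sum>T\<in>tops_over S (insert V (insert U s)). 1 / real (card (T - s) choose 2))
      = (\<Sum>T\<in>tops_over S (insert V (insert U s)). 1 / real (card unused choose 2))"
    by (intro sum.cong refl) (simp add: card_top_minus in_tops_over_iff)
  ultimately show ?thesis unfolding link_pi1_def by simp
qed

lemma edge_iff:
  assumes "i \<in> unused" "U \<in> chain_ext s i" "j \<in> unused" "V \<in> chain_ext s j"
  shows "link_edge Top s U V \<longleftrightarrow> i \<noteq> j \<and> nested U V"
proof
  assume "link_edge Top s U V"
  then have UV: "U \<noteq> V" and "\<exists>T\<in>tops_over S s. {U, V} \<subseteq> T - s"
    unfolding link_edge_def by (rule conjunct1, rule conjunct2)
  then obtain T where "T \<in> tops_over S s" "{U, V} \<subseteq> T - s" by (elim bexE)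
  then have T: "T \<in> Top" "U \<in> T" "V \<in> T" by (simp_all add: in_tops_over_iff)
  have "nested U V"
    using pf_top_chain(1)[OF T(1)] T(2,3) unfolding subspace_chain_def by blast
  moreover have "sdim U \<noteq> sdim V"
    using pf_top_chain(3)[OF T(1)] T(2,3) UV by (metis inj_onD)
  ultimately show "i \<noteq> j \<and> nested U V" using assms by (simp add: chain_ext_def)
next
  assume ij: "i \<noteq> j \<and> nested U V"
  then have "0 < card (tops_over S (insert V (insert U s)))" using tops_edge(2) assms by blast
  then obtain T where "T \<in> tops_over S (insert V (insert U s))"
    by (metis card.empty ex_in_conv less_nat_zero_code)
  moreover have "U \<noteq> V" using ij assms by (auto simp: chain_ext_def)
  ultimately show "link_edge Top s U V"
    using ext_notin[OF assms(1,2)] ext_notin[OF assms(3,4)]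
    unfolding link_edge_def by (intro conjI bexI[of _ T]) (auto simp: in_tops_over_iff)
qed

lemma second_eig_colours_le:
  assumes C: "C \<subseteq> unused" "2 \<le> card C"
    and R: "\<And>i. i \<in> C \<Longrightarrow> (\<Sum>j\<in>C - {i}. (1 / sqrt (real CARD('a))) ^ ((i - j) + (j - i))) \<le> R"
    and M: "\<And>i j U V. i \<in> C \<Longrightarrow> j \<in> C \<Longrightarrow> V \<in> chain_ext s i \<Longrightarrow> U \<in> chain_ext s j \<Longrightarrow>
      M V U = (if i \<noteq> j \<and> nested V U then 1 / (real (card C - 1) * d i j) else 0)"
  shows "second_eig (\<Union>i\<in>C. chain_ext s i) M \<le> R / real (card C - 1)"
proof (rule partite_second_eig_le[where E = "\<lambda>V U. nested V U" and d = d
      and \<rho> = "\<lambda>i j. (1 / sqrt (real CARD('a))) ^ ((i - j) + (j - i))"])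
  show fC: "finite C" using C S_fin finite_subset by blast
  show "2 \<le> card C" by (rule C)
  have i: "i \<notin> used" "i \<le> CARD('n)" "i \<in> unused" if "i \<in> C" for i
    using that C free_le by auto
  show ne: "chain_ext s i \<noteq> {}" if "i \<in> C" for i
    using card_chain_ext(2)[OF s_chain i(1,2)[OF that]] by force
  show "chain_ext s i \<inter> chain_ext s j = {}" if "i \<noteq> j" for i j
    using that by (auto simp: chain_ext_def)
  show deg: "real (card {U \<in> chain_ext s j. nested V U}) = d i j"
    if "i \<in> C" "j \<in> C" "i \<noteq> j" "V \<in> chain_ext s i" for i j V
    using card_chain_ext_comparable(1)[OF s_chain i(1,2)[OF that(2)] i(1,2)[OF that(1)] _ that(4)] that by auto
  show "0 < d i j" if ij: "i \<in> C" "j \<in> C" "i \<noteq> j" for i j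
  proof -
    obtain V where V: "V \<in> chain_ext s i" using ne[OF ij(1)] by blast
    show ?thesis
      using card_chain_ext_comparable(2)[OF s_chain i(1,2)[OF ij(2)] i(1,2)[OF ij(1)] ij(3)[symmetric] V]
      unfolding deg[OF ij V, symmetric] by (simp only: of_nat_0_less_iff)
  qed
  show "2 * (\<Sum>V\<in>chain_ext s i. g V * (\<Sum>U | U \<in> chain_ext s j \<and> nested V U. g U))
      \<le> (1 / sqrt (real CARD('a))) ^ ((i - j) + (j - i)) * (real (card (chain_ext s i)) * d i j)
        * ((\<Sum>V\<in>chain_ext s i. (g V)\<^sup>2) / real (card (chain_ext s i))
          + (\<Sum>U\<in>chain_ext s j. (g U)\<^sup>2) / real (card (chain_ext s j)))"
    if "i \<in> C" "j \<in> C" "i \<noteq> j" "sum g (chain_ext s i) = 0" "sum g (chain_ext s j) = 0" for i j g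
    using comparable_pair_bound[OF s_chain i(1,2)[OF that(1)] i(1,2)[OF that(2)]] that by blast
  show "0 \<le> R"
  proof -
    obtain i where "i \<in> C" using C by fastforce
    have "0 \<le> (\<Sum>j\<in>C - {i}. (1 / sqrt (real CARD('a))) ^ ((i - j) + (j - i)))"
      by (intro sum_nonneg) simp
    then show ?thesis using R[OF \<open>i \<in> C\<close>] by linarith
  qed
qed (use R M in \<open>auto simp: add.commute\<close>)

lemma link_adj_eq:
  assumes two: "2 \<le> card unused" and i: "i \<in> unused" "V \<in> chain_ext s i" and j: "j \<in> unused" "U \<in> chain_ext s j"
  shows "link_adj Top s V U = (if i \<noteq> j \<and> nested V U then 1 / (real (card unused - 1) * d i j) else 0)"
proof (cases "i \<noteq> j \<and> nested V U")
  case True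
  then have e: "link_edge Top s U V" using edge_iff[OF j i] by auto
  let ?m = "real (card unused)" and ?t = "real (card (tops_over S s))"
  define y where "y = real (card (tops_over S (insert U (insert V s))))"
  have y: "0 < y" and v: "real (card (tops_over S (insert V s))) = d i j * y"
    unfolding y_def using tops_edge[OF i(1) j(1) _ i(2) j(2)] True by auto
  have "0 < d i j * y" using tops_vertex[OF i] v by (metis of_nat_0_less_iff)
  then have d: "0 < d i j" using y by (simp add: zero_less_mult_iff)
  have t: "0 < ?t" using tops_pos by simp
  have m: "2 \<le> ?m" using two by simp
  have ch: "real (card unused choose 2) = ?m * (?m - 1) / 2"
    using two by (simp add: choose_two of_nat_diff real_of_nat_div)
  have "link_adj Top s V U = (y / (?m * (?m - 1) / 2) / ?t) / (2 * (d i j * y / ?m / ?t))"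
    using e pi1_eq[OF j i] pi0_eq[OF i] v ch edge_iff[OF i j] True
    by (simp add: link_adj_def y_def insert_commute)
  also have "(y / (m * (m - 1) / 2) / t) / (2 * (e * y / m / t)) = 1 / ((m - 1) * e)"
    if "0 < e" "0 < t" "2 \<le> m" for m t e :: real
    using that y by (simp add: field_simps)
  note this[OF d t m]
  finally show ?thesis using True two by (simp add: of_nat_diff)
next
  case False
  then show ?thesis using edge_iff[OF i j] edge_iff[OF j i] by (auto simp: link_adj_def)
qed

text \<open>All edges from \<open>V\<close> to the other colour carry one common weight, which
  cancels against the total; the remaining colours of the link leave no trace.\<close>

lemma bip_adj_eq:
  assumes two: "2 \<le> card unused" and i: "i \<in> unused" "V \<in> chain_ext s i" and j: "j \<in> unused" "U \<in> chain_ext s j"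
    and k: "k \<in> unused" "l \<in> unused" "k \<noteq> l" and ij: "i \<in> {k, l}" "j \<in> {k, l}"
  shows "bip_adj Top sdim s k l V U = (if i \<noteq> j \<and> nested V U then 1 / d i j else 0)"
proof -
  let ?w = "bip_weight Top sdim s k l" and ?c = "real (card unused choose 2)" and ?t = "real (card (tops_over S s))"
  have V: "sdim V = i" and U: "sdim U = j" using i j by (auto simp: chain_ext_def)
  \<comment> \<open>The one of the two colours \<open>k\<close> and \<open>l\<close> that
    \<open>V\<close> does not have; all edges at \<open>V\<close> in the bipartite graph lead
    there.\<close>
  define o' where "o' = (if i = k then l else k)"
  have o: "o' \<in> unused" "o' \<noteq> i" "o' \<in> {k, l}" using k ij by (auto simp: o'_def)
  have c: "0 < ?c" and t: "0 < ?t" using two tops_pos by (auto simp: zero_less_binomial)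
  define y where "y = real (card (tops_over S (insert V s))) / d i o' / ?c / ?t"
  have w: "?w W V = (if W \<in> chain_ext s o' \<and> nested V W then y else 0)"
    if W: "W \<in> link_vertices Top s" "sdim W = k \<or> sdim W = l" for W
  proof -
    obtain h where h: "h \<in> unused" "W \<in> chain_ext s h" using W link_vertices_eq by auto
    have hW: "sdim W = h" using h by (simp add: chain_ext_def)
    have mem: "W \<in> chain_ext s o' \<longleftrightarrow> h = o'" using h hW by (auto simp: chain_ext_def)
    have ne: "h \<noteq> i \<longleftrightarrow> h = o'" using W(2) hW ij k by (auto simp: o'_def)
    show ?thesis
    proof (cases "h = o' \<and> nested V W")
      case True
      then have "real (card (tops_over S (insert V s))) = d i o' * real (card (tops_over S (insert V (insert W s))))"
        "0 < card (tops_over S (insert V (insert W s)))"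
        using tops_edge[OF i(1) o(1) _ i(2), of W] h o by (auto simp: insert_commute)
      moreover have "0 < card (tops_over S (insert V s))" by (rule tops_vertex[OF i])
      ultimately have "d i o' \<noteq> 0" "real (card (tops_over S (insert V s))) / d i o' = real (card (tops_over S (insert V (insert W s))))"
        by auto
      then show ?thesis
        using True pi1_eq[OF h i] edge_iff[OF h i] mem ne hW V W ij
        by (auto simp: bip_weight_def y_def o'_def split: if_splits)
    next
      case False
      then show ?thesis using edge_iff[OF h i] mem ne by (auto simp: bip_weight_def)
    qed
  qed
  have deg: "real (card {W \<in> chain_ext s o'. nested V W}) = d i o'" "0 < card {W \<in> chain_ext s o'. nested V W}"
    using card_chain_ext_comparable[OF s_chain _ free_le[OF o(1)] _ free_le[OF i(1)] o(2) i(2)] i o by auto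
  have "0 < d i o'" unfolding deg(1)[symmetric] using deg(2) by (simp only: of_nat_0_less_iff)
  moreover have "0 < real (card (tops_over S (insert V s)))"
    using tops_vertex[OF i] by (simp only: of_nat_0_less_iff)
  ultimately have y: "0 < y" unfolding y_def using c t by (intro divide_pos_pos)
  have "(\<Sum>W\<in>bip_vertices Top sdim s k l. ?w W V)
      = (\<Sum>W\<in>bip_vertices Top sdim s k l. if W \<in> chain_ext s o' \<and> nested V W then y else 0)"
    by (intro sum.cong refl) (auto simp: bip_vertices_def w)
  also have "\<dots> = (\<Sum>W | W \<in> bip_vertices Top sdim s k l \<and> (W \<in> chain_ext s o' \<and> nested V W). y)"
    by (rule sum.inter_filter[symmetric]) simp
  also have "{W \<in> bip_vertices Top sdim s k l. W \<in> chain_ext s o' \<and> nested V W} = {W \<in> chain_ext s o'. nested V W}"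
    using o by (auto simp: bip_vertices_def link_vertices_eq) (auto simp: chain_ext_def)
  finally have total: "(\<Sum>W\<in>bip_vertices Top sdim s k l. ?w W V) = d i o' * y" using deg by simp
  have "U \<in> link_vertices Top s" using j link_vertices_eq by blast
  then have "?w U V = (if i \<noteq> j \<and> nested V U then y else 0)"
    using w[of U] U ij j k by (auto simp: o'_def chain_ext_def)
  moreover have "i \<noteq> j \<Longrightarrow> o' = j" using ij by (auto simp: o'_def)
  ultimately show ?thesis unfolding bip_adj_def total using y by auto
qed

lemma bip_vertices_eq:
  assumes "k \<in> unused" "l \<in> unused"
  shows "bip_vertices Top sdim s k l = (\<Union>i\<in>{k, l}. chain_ext s i)"
  using assms by (auto simp: bip_vertices_def link_vertices_eq) (auto simp: chain_ext_def)

lemma inv_sqrt_q: "0 \<le> 1 / sqrt (real CARD('a))" "1 / sqrt (real CARD('a)) < 1" "1 < sqrt (real CARD('a))"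
  using card_field_ge_2[where 'a='a] by auto

theorem link_lambda2_le:
  assumes "card s + 2 \<le> card S"
  shows "link_lambda2 Top s \<le> 2 / (real (card S - card s - 1) * (sqrt (real CARD('a)) - 1))"
proof -
  let ?r = "1 / sqrt (real CARD('a))"
  have two: "2 \<le> card unused" using assms card_free by simp
  \<comment> \<open>With \<open>?r = 1 / sqrt q\<close>, the two-sided geometric series is the
    numerical constant of the bound.\<close>
  have R: "2 * (?r / (1 - ?r)) = 2 / (sqrt (real CARD('a)) - 1)"
    using inv_sqrt_q by (simp add: field_simps)
  have "second_eig (\<Union>i\<in>unused. chain_ext s i) (link_adj Top s) \<le> 2 * (?r / (1 - ?r)) / real (card unused - 1)"
  proof (rule second_eig_colours_le[OF order_refl two])
    show "(\<Sum>j\<in>unused - {i}. ?r ^ ((i - j) + (j - i))) \<le> 2 * (?r / (1 - ?r))" for i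
      using S_fin by (intro sum_distance_powers_le inv_sqrt_q) simp
  qed (rule link_adj_eq[OF two])
  then show ?thesis
    unfolding link_lambda2_def link_vertices_eq R card_free by (simp add: mult.commute)
qed

theorem bipartite_second_eig_le:
  assumes "card s + 2 \<le> card S" and k: "k \<in> unused" "l \<in> unused" "k \<noteq> l"
  shows "second_eig (bip_vertices Top sdim s k l) (bip_adj Top sdim s k l) \<le> 1 / sqrt (real CARD('a))"
proof -
  let ?r = "1 / sqrt (real CARD('a))"
  have two: "2 \<le> card unused" using assms card_free by simp
  have C: "card {k, l} = 2" using k by simp
  have "second_eig (\<Union>i\<in>{k, l}. chain_ext s i) (bip_adj Top sdim s k l) \<le> ?r / real (card {k, l} - 1)"
  proof (rule second_eig_colours_le)
    fix i assume i: "i \<in> {k, l}"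
    \<comment> \<open>With a single other colour the row sum is one power of \<open>?r\<close>, and
      distinct colours make its exponent at least one.\<close>
    have pow: "?r ^ ((x - y) + (y - x)) \<le> ?r" if "x \<noteq> y" for x y
      using power_decreasing[of 1 "(x - y) + (y - x)" ?r] inv_sqrt_q that by auto
    have "{k, l} - {i} = {l} \<or> {k, l} - {i} = {k}" using i k by auto
    then show "(\<Sum>j\<in>{k, l} - {i}. ?r ^ ((i - j) + (j - i))) \<le> ?r"
      using pow[of i] i k by auto
  next
    fix i j U V assume ij: "i \<in> {k, l}" "j \<in> {k, l}" and VU: "V \<in> chain_ext s i" "U \<in> chain_ext s j"
    then have un: "i \<in> unused" "j \<in> unused" using k by auto
    show "bip_adj Top sdim s k l V U = (if i \<noteq> j \<and> nested V U then 1 / (real (card {k, l} - 1) * d i j) else 0)"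
      unfolding bip_adj_eq[OF two un(1) VU(1) un(2) VU(2) k ij] C by simp
  qed (use k C in auto)
  then show ?thesis using C bip_vertices_eq[OF k(1,2)] by simp
qed

end

theorem theorem1p3:
  fixes S :: "nat set"
  assumes d3: "card (UNIV :: 'n::finite set) \<ge> 3"
    and S_sub: "S \<subseteq> {1..<card (UNIV :: 'n set)}"
    and S_card: "card S \<ge> 2"
  shows "(\<forall>s \<in> faces_of (pf_top S :: ('n \<Rightarrow> 'a::{field,finite}) set set set).
            card s + 2 \<le> card S \<longrightarrow>
            link_lambda2 (pf_top S) s
              \<le> 2 / (real (card S - card s - 1) * (sqrt (real (card (UNIV :: 'a set))) - 1)))
       \<and> local_spectral_expander (card S) (pf_top S :: ('n \<Rightarrow> 'a) set set set)
            (2 / (sqrt (real (card (UNIV :: 'a set))) - 1))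
       \<and> is_product S sdim (pf_top S :: ('n \<Rightarrow> 'a) set set set) (1 / sqrt (real (card (UNIV :: 'a set))))"
proof (intro conjI)
  let ?top = "pf_top S :: ('n \<Rightarrow> 'a) set set set"
  let ?bound = "\<lambda>s. 2 / (real (card S - card s - 1) * (sqrt (real CARD('a)) - 1))"
  have link: "flag_link S s" if "s \<in> faces_of ?top" for s
    using that S_sub by unfold_locales
  show *: "\<forall>s\<in>faces_of ?top. card s + 2 \<le> card S \<longrightarrow> link_lambda2 ?top s \<le> ?bound s"
    using flag_link.link_lambda2_le[OF link] by blast
  show "local_spectral_expander (card S) ?top (2 / (sqrt (real CARD('a)) - 1))"
    unfolding local_spectral_expander_def
  proof (intro ballI impI)
    fix s assume s: "s \<in> faces_of ?top" "card s + 2 \<le> card S"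
    then have "link_lambda2 ?top s \<le> ?bound s" using * by blast
    \<comment> \<open>Co-dimension at least two makes \<open>card S - card s - 1\<close> at least
      one.\<close>
    also have "\<dots> \<le> 2 / (1 * (sqrt (real CARD('a)) - 1))"
      using s(2) card_field_ge_2[where 'a='a] by (intro divide_left_mono mult_right_mono mult_pos_pos) auto
    finally show "link_lambda2 ?top s \<le> 2 / (sqrt (real CARD('a)) - 1)" by simp
  qed
  show "is_product S sdim ?top (1 / sqrt (real CARD('a)))"
    unfolding is_product_def using flag_link.bipartite_second_eig_le[OF link] by blast
qed

end
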